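(* Consider the online allocation problem and Algorithm 1 described in the context, with step-size $\eta\ge0$ and initial dual solution $\mu_1\in\mathbb{R}^m_+$. Suppose Assumption 1 and Assumption 2 hold. Let $q\ge1$ be an integer with $T$ divisible by $q$, and let $\mathcal C^{\mathrm P}(q)$ be the set of joint distributions of $\vec\gamma\in\mathcal S^T$ under which the blocks $(\gamma_1,\dots,\gamma_q),(\gamma_{q+1},\dots,\gamma_{2q}),\dots,(\gamma_{T-q+1},\dots,\gamma_T)$ are independent and identically distributed (requests within a block may be arbitrarily correlated). Then for every $T\ge1$ and such $q$, $$\sup_{\mathcal P\in\mathcal C^{\mathrm P}(q)}\mathbb{E}_{\vec\gamma\sim\mathcal P}\big[\mathrm{OPT}(\vec\gamma)-R(A\mid\vec\gamma)\big]\le C_1+C_2\eta T+\frac{C_3}{\eta}+C_4q\eta T,$$ with $C_1=\bar f\bar b/\underline\rho$, $C_2=(\bar b+\bar\rho)^2/(2\sigma)$, $C_3=\max\{V_h(\mu,\mu_1):\mu\in\{0,(\bar f/\rho_1)e_1,\ldots,(\bar f/\rho_m)e_m\}\}$ and $C_4=\frac{\sqrt2}{\sigma}(\bar b+\bar\rho)^2$.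
   Context: Online allocation problem: horizon $T\ge1$, $m\ge1$ resources. A request is $\gamma=(f,b,\mathcal X)$ with $\mathcal X\subset\mathbb{R}^d_+$ compact, $0\in\mathcal X$, $f:\mathcal X\to\mathbb{R}_+$, $b:\mathcal X\to\mathbb{R}^m_+$, $b(0)=0$; $\mathcal S$ is the set of possible requests; $e_j$ the $j$-th unit vector. Resource vector $\rho$, all $\rho_j>0$, total resources $T\rho$; $\underline\rho=\min_j\rho_j$, $\bar\rho=\max_j\rho_j$. $\mathrm{OPT}(\vec\gamma)=\max\{\sum_t f_t(x_t):x_t\in\mathcal X_t,\sum_t b_t(x_t)\le T\rho\}$; $R(A\mid\vec\gamma)=\sum_t f_t(x_t)$. Assumption 1: there exist $\bar f,\bar b\ge0$ such that for every $(f,b,\mathcal X)\in\mathcal S$: $0\in\mathcal X$; $0\le f\le\bar f$; $b\ge0$, $\|b(x)\|_\infty\le\bar b$; $\max_{x\in\mathcal X}\{f(x)-\mu^\top b(x)\}$ attained for all $\mu\in\mathbb{R}^m_+$. Assumption 2: $h$ differentiable (or essentially smooth) on $\mathbb{R}^m_+$ and $\sigma$-strongly convex w.r.t. $\|\cdot\|_1$ there. $V_h(x,y)=h(x)-h(y)-\nabla h(y)^\top(x-y)$. Algorithm 1: $B_1=T\rho$; for each $t$: $\tilde x_t\in\arg\max_{x\in\mathcal X_t}\{f_t(x)-\mu_t^\top b_t(x)\}$; $x_t=\tilde x_t$ if $b_t(\tilde x_t)\le B_t$, else $0$; $B_{t+1}=B_t-b_t(x_t)$; $\tilde g_t=\rho-b_t(\tilde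 x_t)$; $\mu_{t+1}=\arg\min_{\mu\in\mathbb{R}^m_+}\{\tilde g_t^\top\mu+\frac1\eta V_h(\mu,\mu_t)\}$. *)

theory Defs
  imports "HOL-Probability.Probability"
begin

subsection \<open>Requests\<close>

abbreviation orthant :: "(real ^ 'n::finite) set" where
  "orthant \<equiv> {x. 0 \<le> x}"

text \<open>The maps \<open>reward\<close> and \<open>consumption\<close> are only meaningful on \<open>actions\<close>.\<close>

datatype ('d::finite, 'm::finite) request =
  Request (reward: "real ^ 'd \<Rightarrow> real")
          (consumption: "real ^ 'd \<Rightarrow> real ^ 'm")
          (actions: "(real ^ 'd) set")

definition well_formed :: "('d::finite, 'm::finite) request \<Rightarrow> bool" where
  "well_formed r \<longleftrightarrow>
     compact (actions r) \<and> actions r \<subseteq> orthant \<and> 0 \<in> actions r \<and>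
     (\<forall>x\<in>actions r. 0 \<le> reward r x) \<and>
     (\<forall>x\<in>actions r. 0 \<le> consumption r x) \<and>
     consumption r 0 = 0"

definition lagrangian :: "('d::finite, 'm::finite) request \<Rightarrow> real ^ 'm \<Rightarrow> real ^ 'd \<Rightarrow> real" where
  "lagrangian r \<mu> x = reward r x - \<mu> \<bullet> consumption r x"

definition bounded_requests ::
  "('d::finite, 'm::finite) request set \<Rightarrow> real \<Rightarrow> real \<Rightarrow> bool" where
  "bounded_requests S fbar bbar \<longleftrightarrow> 0 \<le> fbar \<and> 0 \<le> bbar \<and>
     (\<forall>r\<in>S. 0 \<in> actions r \<and>
        (\<forall>x\<in>actions r. 0 \<le> reward r x \<and> reward r x \<le> fbar \<and>
           0 \<le> consumption r x \<and> infnorm (consumption r x) \<le> bbar) \<and>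
        (\<forall>\<mu>\<in>orthant. \<exists>x. is_arg_max (lagrangian r \<mu>) (\<lambda>x. x \<in> actions r) x))"


subsection \<open>Hindsight optimum and collected reward\<close>

text \<open>
  Time is indexed from \<open>0\<close>: the requests are \<open>\<gamma> 0, \<dots>, \<gamma> (T - 1)\<close>.  Since rewards and
  consumptions need not be continuous, the hindsight optimum is a supremum, which is the
  maximum whenever the latter is attained.
\<close>

definition total_reward ::
  "nat \<Rightarrow> (nat \<Rightarrow> ('d::finite, 'm::finite) request) \<Rightarrow> (nat \<Rightarrow> real ^ 'd) \<Rightarrow> real" where
  "total_reward T \<gamma> x = (\<Sum>t<T. reward (\<gamma> t) (x t))"

definition hindsight_opt ::
  "nat \<Rightarrow> real ^ 'm \<Rightarrow> (nat \<Rightarrow> ('d::finite, 'm::finite) request) \<Rightarrow> real" where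
  "hindsight_opt T \<rho> \<gamma> =
     (SUP x \<in> {x. (\<forall>t<T. x t \<in> actions (\<gamma> t)) \<and>
                  (\<Sum>t<T. consumption (\<gamma> t) (x t)) \<le> real T *\<^sub>R \<rho>}.
        total_reward T \<gamma> x)"


subsection \<open>Reference functions\<close>

definition l1norm :: "real ^ 'm::finite \<Rightarrow> real" where
  "l1norm x = (\<Sum>i\<in>UNIV. \<bar>x $ i\<bar>)"

text \<open>
  Derivatives are taken within the orthant, hence are one-sided at its boundary.  They are unique
  there, as the orthant contains all directions \<open>axis i 1\<close> at each of its points.
\<close>

definition grad :: "(real ^ 'm::finite \<Rightarrow> real) \<Rightarrow> real ^ 'm \<Rightarrow> real ^ 'm" where
  "grad h y = (\<chi> i. frechet_derivative h (at y within orthant) (axis i 1))"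

definition bregman :: "(real ^ 'm::finite \<Rightarrow> real) \<Rightarrow> real ^ 'm \<Rightarrow> real ^ 'm \<Rightarrow> real" where
  "bregman h x y = h x - h y - grad h y \<bullet> (x - y)"

definition essentially_smooth :: "(real ^ 'm::finite \<Rightarrow> real) \<Rightarrow> bool" where
  "essentially_smooth h \<longleftrightarrow>
     h differentiable_on interior orthant \<and>
     (\<forall>y\<in>frontier orthant.
        filterlim (\<lambda>z. norm (grad h z)) at_top (at y within interior orthant))"

definition strongly_convex :: "real \<Rightarrow> (real ^ 'm::finite \<Rightarrow> real) \<Rightarrow> bool" where
  "strongly_convex \<sigma> h \<longleftrightarrow>
     (\<forall>x\<in>orthant. \<forall>y\<in>orthant. \<forall>u\<in>{0..1}.
        h ((1 - u) *\<^sub>R x + u *\<^sub>R y)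
          \<le> (1 - u) * h x + u * h y - \<sigma> / 2 * u * (1 - u) * (l1norm (x - y))\<^sup>2)"

definition reference_function :: "real \<Rightarrow> (real ^ 'm::finite \<Rightarrow> real) \<Rightarrow> bool" where
  "reference_function \<sigma> h \<longleftrightarrow> 0 < \<sigma> \<and>
     (h differentiable_on orthant \<or> essentially_smooth h) \<and> strongly_convex \<sigma> h"


subsection \<open>Dual mirror descent\<close>

text \<open>
  The objective of the dual step is extended-real valued so that it also makes sense for step size
  \<open>0\<close>, where \<open>1 / 0 = \<infinity>\<close> and \<open>\<infinity> * 0 = 0\<close>, so that the minimiser is the previous iterate.
\<close>

definition mirror_objective ::
  "real \<Rightarrow> (real ^ 'm::finite \<Rightarrow> real) \<Rightarrow> real ^ 'm \<Rightarrow> real ^ 'm \<Rightarrow> real ^ 'm \<Rightarrow> ereal" where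
  "mirror_objective \<eta> h g \<mu>' \<mu> =
     ereal (g \<bullet> \<mu>) + (1 / ereal \<eta>) * ereal (bregman h \<mu> \<mu>')"

text \<open>
  One run on the requests \<open>\<gamma>\<close>: \<open>xt\<close> are the unconstrained maximisers, \<open>x\<close> the actions taken,
  \<open>B\<close> the remaining resources and \<open>\<mu>\<close> the dual iterates.
\<close>

definition mirror_descent_run ::
  "nat \<Rightarrow> real ^ 'm \<Rightarrow> real \<Rightarrow> (real ^ 'm \<Rightarrow> real) \<Rightarrow> real ^ 'm \<Rightarrow>
   (nat \<Rightarrow> ('d::finite, 'm::finite) request) \<Rightarrow>
   (nat \<Rightarrow> real ^ 'd) \<Rightarrow> (nat \<Rightarrow> real ^ 'd) \<Rightarrow> (nat \<Rightarrow> real ^ 'm) \<Rightarrow> (nat \<Rightarrow> real ^ 'm) \<Rightarrow> bool" where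
  "mirror_descent_run T \<rho> \<eta> h \<mu>1 \<gamma> xt x B \<mu> \<longleftrightarrow>
     B 0 = real T *\<^sub>R \<rho> \<and> \<mu> 0 = \<mu>1 \<and>
     (\<forall>t<T.
        is_arg_max (lagrangian (\<gamma> t) (\<mu> t)) (\<lambda>z. z \<in> actions (\<gamma> t)) (xt t) \<and>
        x t = (if consumption (\<gamma> t) (xt t) \<le> B t then xt t else 0) \<and>
        B (Suc t) = B t - consumption (\<gamma> t) (x t) \<and>
        is_arg_min (mirror_objective \<eta> h (\<rho> - consumption (\<gamma> t) (xt t)) (\<mu> t))
          (\<lambda>\<nu>. \<nu> \<in> orthant) (\<mu> (Suc t)))"

text \<open>
  The algorithm may break ties among maximisers in any way that uses only the requests seen so far.
  The other components of a run are determined by \<open>xt\<close>.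
\<close>

definition mirror_descent_algorithm ::
  "nat \<Rightarrow> real ^ 'm \<Rightarrow> real \<Rightarrow> (real ^ 'm \<Rightarrow> real) \<Rightarrow> real ^ 'm \<Rightarrow>
   ('d::finite, 'm::finite) request set \<Rightarrow>
   ((nat \<Rightarrow> ('d, 'm) request) \<Rightarrow> nat \<Rightarrow> real ^ 'd) \<Rightarrow>
   ((nat \<Rightarrow> ('d, 'm) request) \<Rightarrow> nat \<Rightarrow> real ^ 'd) \<Rightarrow>
   ((nat \<Rightarrow> ('d, 'm) request) \<Rightarrow> nat \<Rightarrow> real ^ 'm) \<Rightarrow>
   ((nat \<Rightarrow> ('d, 'm) request) \<Rightarrow> nat \<Rightarrow> real ^ 'm) \<Rightarrow> bool" where
  "mirror_descent_algorithm T \<rho> \<eta> h \<mu>1 S xt x B \<mu> \<longleftrightarrow>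
     (\<forall>\<gamma>\<in>{..<T} \<rightarrow>\<^sub>E S.
        mirror_descent_run T \<rho> \<eta> h \<mu>1 \<gamma> (xt \<gamma>) (x \<gamma>) (B \<gamma>) (\<mu> \<gamma>)) \<and>
     (\<forall>\<gamma>\<in>{..<T} \<rightarrow>\<^sub>E S. \<forall>\<gamma>'\<in>{..<T} \<rightarrow>\<^sub>E S. \<forall>t<T.
        (\<forall>s\<le>t. \<gamma> s = \<gamma>' s) \<longrightarrow> xt \<gamma> t = xt \<gamma>' t)"


subsection \<open>Distributions of request sequences\<close>

text \<open>
  The \<open>\<sigma>\<close>-algebra on the requests is that of \<open>M\<close>; its measure is irrelevant.  Expectations
  presuppose that the quantities involved are random variables: the dual function
  \<open>max (f x - \<mu>\<^sup>T b x)\<close> of a request, the hindsight optimum, and the rewards, consumptions and dual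
  iterates of the algorithm.
\<close>

definition measurable_model ::
  "nat \<Rightarrow> real ^ 'm \<Rightarrow> ('d::finite, 'm::finite) request measure \<Rightarrow>
   ((nat \<Rightarrow> ('d, 'm) request) \<Rightarrow> nat \<Rightarrow> real ^ 'd) \<Rightarrow>
   ((nat \<Rightarrow> ('d, 'm) request) \<Rightarrow> nat \<Rightarrow> real ^ 'd) \<Rightarrow>
   ((nat \<Rightarrow> ('d, 'm) request) \<Rightarrow> nat \<Rightarrow> real ^ 'm) \<Rightarrow> bool" where
  "measurable_model T \<rho> M xt x \<mu> \<longleftrightarrow>
     (\<forall>\<nu>\<in>orthant. (\<lambda>r. SUP z\<in>actions r. lagrangian r \<nu> z) \<in> borel_measurable M) \<and>
     hindsight_opt T \<rho> \<in> borel_measurable (\<Pi>\<^sub>M t\<in>{..<T}. M) \<and>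
     (\<forall>t<T.
        (\<lambda>\<gamma>. reward (\<gamma> t) (xt \<gamma> t)) \<in> borel_measurable (\<Pi>\<^sub>M t\<in>{..<T}. M) \<and>
        (\<lambda>\<gamma>. consumption (\<gamma> t) (xt \<gamma> t)) \<in> borel_measurable (\<Pi>\<^sub>M t\<in>{..<T}. M) \<and>
        (\<lambda>\<gamma>. reward (\<gamma> t) (x \<gamma> t)) \<in> borel_measurable (\<Pi>\<^sub>M t\<in>{..<T}. M) \<and>
        (\<lambda>\<gamma>. \<mu> \<gamma> t) \<in> borel_measurable (\<Pi>\<^sub>M t\<in>{..<T}. M))"

definition block :: "nat \<Rightarrow> nat \<Rightarrow> (nat \<Rightarrow> 'r) \<Rightarrow> nat \<Rightarrow> 'r" where
  "block q k \<gamma> = (\<lambda>i\<in>{..<q}. \<gamma> (k * q + i))"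

definition periodic_laws :: "nat \<Rightarrow> 'r measure \<Rightarrow> nat \<Rightarrow> (nat \<Rightarrow> 'r) measure set" where
  "periodic_laws T M q =
     {P. prob_space P \<and> sets P = sets (\<Pi>\<^sub>M t\<in>{..<T}. M) \<and>
         prob_space.indep_vars P (\<lambda>_. \<Pi>\<^sub>M i\<in>{..<q}. M) (block q) {..<T div q} \<and>
         (\<forall>k<T div q. \<forall>l<T div q.
            distr P (\<Pi>\<^sub>M i\<in>{..<q}. M) (block q k) = distr P (\<Pi>\<^sub>M i\<in>{..<q}. M) (block q l))}"

end

theory Submission
  imports Defs
begin

text \<open>
  Up to the stopping time at which a maximiser is first rejected, the rewards are
  \<open>d\<^sub>t(\<mu>\<^sub>t) - g\<^sub>t \<bullet> \<mu>\<^sub>t\<close> with \<open>d\<^sub>t(\<nu>) = max (f\<^sub>t - \<nu> \<bullet> b\<^sub>t) + \<nu> \<bullet> \<rho>\<close>; the regret of mirror descent against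
  \<open>0\<close> or \<open>(fbar / \<rho>\<^sub>j) e\<^sub>j\<close>, where \<open>j\<close> is the exhausted resource, pays for the rewards missed after
  stopping.  Inside a block the price \<open>\<mu>\<^sub>t\<close> is replaced by the price at the beginning of the block,
  which is independent of the block, and weak duality bounds the hindsight optimum by the expected
  values of \<open>d\<^sub>t\<close>.

  The stopping time may fall into the middle of a block, and completing that block costs up to
  \<open>q (\<rho> \<bullet> \<mu>)\<close>, where only \<open>\<rho> \<bullet> \<mu> < fbar\<close> matters.  This is absorbed by the slack in \<open>C4\<close>: the
  subgradients are bounded by \<open>max bbar \<rho>max\<close> rather than \<open>bbar + \<rho>max\<close>, and unless \<open>C3 / \<eta>\<close>
  exceeds the trivial bound \<open>T fbar\<close>, the step size \<open>\<eta>\<close> is so large that the slack dominates the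
  price.
\<close>

subsection \<open>Mirror descent steps\<close>

lemma l1norm_nonneg: "0 \<le> l1norm x"
  by (simp add: l1norm_def sum_nonneg)

lemma l1norm_minus_commute: "l1norm (x - y) = l1norm (y - x)"
  by (simp add: l1norm_def abs_minus_commute)

lemma l1norm_triangle: "l1norm (x - z) \<le> l1norm (x - y) + l1norm (y - z)"
  unfolding l1norm_def sum.distrib[symmetric] by (rule sum_mono) simp

lemma l1norm_eq_0: "l1norm x = 0 \<longleftrightarrow> x = 0"
  by (simp add: l1norm_def sum_nonneg_eq_0_iff vec_eq_iff)

lemma inner_le_l1norm:
  assumes "\<And>i. \<bar>g $ i\<bar> \<le> c"
  shows "g \<bullet> v \<le> c * l1norm v"
  unfolding inner_vec_def l1norm_def sum_distrib_left
proof (rule sum_mono)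
  fix i
  have "g $ i * v $ i \<le> \<bar>g $ i\<bar> * \<bar>v $ i\<bar>" by (metis abs_ge_self abs_mult)
  also have "\<dots> \<le> c * \<bar>v $ i\<bar>" by (intro mult_right_mono assms) simp
  finally show "inner (g $ i) (v $ i) \<le> c * \<bar>v $ i\<bar>" by simp
qed

lemma inner_nonneg_orthant:
  fixes x y :: "real ^ 'm::finite"
  assumes "0 \<le> x" "0 \<le> y"
  shows "0 \<le> x \<bullet> y"
  using assms by (auto simp: inner_vec_def less_eq_vec_def intro!: sum_nonneg)

section \<open>One-sided derivatives and Bregman divergences on the orthant\<close>

lemma convex_orthant: "convex (orthant :: (real ^ 'm::finite) set)"
  by (auto simp: convex_def less_eq_vec_def)

lemma has_derivative_grad:
  fixes h :: "real ^ 'm::finite \<Rightarrow> real"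
  assumes "h differentiable (at y within orthant)"
  shows "(h has_derivative (\<lambda>v. grad h y \<bullet> v)) (at y within orthant)"
proof -
  let ?D = "frechet_derivative h (at y within orthant)"
  have D: "(h has_derivative ?D) (at y within orthant)"
    using assms frechet_derivative_works by blast
  then have "linear ?D" by (rule has_derivative_linear)
  then have "?D v = grad h y \<bullet> v" for v
    by (subst basis_expansion[of v, symmetric])
      (simp add: linear_sum linear_scale scalar_mult_eq_scaleR grad_def inner_vec_def mult.commute)
  then show ?thesis using D by (metis (no_types, lifting) ext)
qed

text \<open>Convexity keeps the segment from \<open>y\<close> to \<open>x\<close> inside
  \<open>K\<close>, so the chain rule along it needs only the derivative within \<open>K\<close>.
  This covers boundary points of the orthant.\<close>

lemma directional_derivative_tendsto:
  fixes h :: "'a::real_normed_vector \<Rightarrow> real"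
  assumes "(h has_derivative D) (at y within K)" "convex K" "x \<in> K" "y \<in> K"
  shows "((\<lambda>u. (h (y + u *\<^sub>R (x - y)) - h y) / u) \<longlongrightarrow> D (x - y)) (at_right 0)"
proof -
  let ?p = "\<lambda>u. y + u *\<^sub>R (x - y)"
  have im: "?p ` {0..1} \<subseteq> K"
  proof
    fix z assume "z \<in> ?p ` {0..1}"
    then obtain u where "u \<in> {0..1}" "z = (1 - u) *\<^sub>R y + u *\<^sub>R x"
      by (auto simp: algebra_simps)
    then show "z \<in> K" using assms(2-4) by (auto intro: convexD_alt)
  qed
  have "(?p has_derivative (\<lambda>u. u *\<^sub>R (x - y))) (at 0 within {0..1})"
    by (auto intro!: derivative_eq_intros)
  moreover have "(h has_derivative D) (at (?p 0) within ?p ` {0..1})"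
    using has_derivative_subset[OF assms(1) im] by simp
  ultimately have "((\<lambda>u. h (?p u)) has_derivative (\<lambda>u. D (u *\<^sub>R (x - y)))) (at 0 within {0..1})"
    by (rule has_derivative_in_compose)
  moreover have "D (u *\<^sub>R (x - y)) = D (x - y) * u" for u
    using has_derivative_linear[OF assms(1)] by (simp add: linear_scale)
  ultimately have "((\<lambda>u. h (?p u)) has_field_derivative D (x - y)) (at 0 within {0..1})"
    by (simp add: has_field_derivative_def)
  then show ?thesis
    by (simp add: has_field_derivative_iff at_within_Icc_at_right)
qed

text \<open>Strong convexity bounds the difference quotient of \<open>h\<close> along the segment
  from \<open>y\<close> to \<open>x\<close>; the claim is the limit for \<open>u\<close> tending to
  0 from the right.\<close>

lemma bregman_lower_bound:
  fixes h :: "real ^ 'm::finite \<Rightarrow> real"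
  assumes "strongly_convex \<sigma> h" "h differentiable (at y within orthant)" "x \<in> orthant" "y \<in> orthant"
  shows "\<sigma> / 2 * (l1norm (x - y))\<^sup>2 \<le> bregman h x y"
proof -
  let ?N = "(l1norm (x - y))\<^sup>2"
  have lim: "((\<lambda>u. (h (y + u *\<^sub>R (x - y)) - h y) / u) \<longlongrightarrow> grad h y \<bullet> (x - y)) (at_right 0)"
    by (rule directional_derivative_tendsto[OF has_derivative_grad[OF assms(2)] convex_orthant assms(3,4)])
  have "((\<lambda>u. h x - h y - \<sigma> / 2 * (1 - u) * ?N) \<longlongrightarrow> h x - h y - \<sigma> / 2 * (1 - 0) * ?N) (at_right 0)"
    by (intro tendsto_intros)
  moreover have "\<forall>\<^sub>F u in at_right 0. (h (y + u *\<^sub>R (x - y)) - h y) / u \<le> h x - h y - \<sigma> / 2 * (1 - u) * ?N"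
    unfolding eventually_at_right_field
  proof (intro exI[of _ 1] conjI allI impI)
    fix u :: real assume u: "0 < u" "u < 1"
    have "h ((1 - u) *\<^sub>R y + u *\<^sub>R x) \<le> (1 - u) * h y + u * h x - \<sigma> / 2 * u * (1 - u) * (l1norm (y - x))\<^sup>2"
      using assms(1,3,4) u unfolding strongly_convex_def by simp
    moreover have "(1 - u) *\<^sub>R y + u *\<^sub>R x = y + u *\<^sub>R (x - y)" by (simp add: algebra_simps)
    ultimately have "h (y + u *\<^sub>R (x - y)) - h y \<le> u * (h x - h y - \<sigma> / 2 * (1 - u) * ?N)"
      by (simp add: l1norm_minus_commute[of y x] algebra_simps)
    then show "(h (y + u *\<^sub>R (x - y)) - h y) / u \<le> h x - h y - \<sigma> / 2 * (1 - u) * ?N"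
      using u by (simp add: pos_divide_le_eq mult.commute)
  qed simp
  ultimately have "grad h y \<bullet> (x - y) \<le> h x - h y - \<sigma> / 2 * (1 - 0) * ?N"
    by (intro tendsto_le[OF trivial_limit_at_right_real _ lim])
  then show ?thesis by (simp add: bregman_def)
qed

section \<open>Optimality, differentiability and uniqueness of the dual step\<close>

lemma mirror_objective_pos:
  assumes "0 < \<eta>"
  shows "mirror_objective \<eta> h g \<mu>' \<mu> = ereal (g \<bullet> \<mu> + bregman h \<mu> \<mu>' / \<eta>)"
  using assms by (simp add: mirror_objective_def one_ereal_def)

text \<open>Multiplying the objective by \<open>\<eta>\<close> and dropping constants leaves
  \<open>h\<close> plus a linear function, the form in which the first-order condition and the
  interiority argument are stated.\<close>

lemma minimizer_linear_perturbation:
  assumes "0 < \<eta>" "is_arg_min (mirror_objective \<eta> h g \<mu>) (\<lambda>\<nu>. \<nu> \<in> orthant) \<mu>'" "\<nu> \<in> orthant"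
  shows "(\<eta> *\<^sub>R g - grad h \<mu>) \<bullet> \<mu>' + h \<mu>' \<le> (\<eta> *\<^sub>R g - grad h \<mu>) \<bullet> \<nu> + h \<nu>"
proof -
  have "g \<bullet> \<mu>' + bregman h \<mu>' \<mu> / \<eta> \<le> g \<bullet> \<nu> + bregman h \<nu> \<mu> / \<eta>"
    using assms by (auto simp: is_arg_min_def mirror_objective_pos not_less)
  then have "\<eta> * (g \<bullet> \<mu>' + bregman h \<mu>' \<mu> / \<eta>) \<le> \<eta> * (g \<bullet> \<nu> + bregman h \<nu> \<mu> / \<eta>)"
    using assms(1) by simp
  then have "\<eta> * (g \<bullet> \<mu>') + bregman h \<mu>' \<mu> \<le> \<eta> * (g \<bullet> \<nu>) + bregman h \<nu> \<mu>"
    using assms(1) by (simp add: distrib_left)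
  then show ?thesis by (simp add: bregman_def algebra_simps)
qed

text \<open>Minimality along the segment bounds the difference quotients of \<open>h\<close> from
  below by \<open>- (w \<bullet> (x - y))\<close>, and the bound passes to the one-sided
  limit.\<close>

lemma minimizer_first_order:
  fixes h :: "real ^ 'm::finite \<Rightarrow> real"
  assumes "h differentiable (at y within orthant)" "y \<in> orthant" "x \<in> orthant"
    and min: "\<And>\<nu>. \<nu> \<in> orthant \<Longrightarrow> w \<bullet> y + h y \<le> w \<bullet> \<nu> + h \<nu>"
  shows "0 \<le> (w + grad h y) \<bullet> (x - y)"
proof -
  let ?p = "\<lambda>u. y + u *\<^sub>R (x - y)"
  have "((\<lambda>u. (h (?p u) - h y) / u) \<longlongrightarrow> grad h y \<bullet> (x - y)) (at_right 0)"
    by (rule directional_derivative_tendsto[OF has_derivative_grad[OF assms(1)] convex_orthant assms(3,2)])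
  moreover have "\<forall>\<^sub>F u in at_right 0. - (w \<bullet> (x - y)) \<le> (h (?p u) - h y) / u"
    unfolding eventually_at_right_field
  proof (intro exI[of _ 1] conjI allI impI)
    fix u :: real assume u: "0 < u" "u < 1"
    have "?p u = (1 - u) *\<^sub>R y + u *\<^sub>R x" by (simp add: algebra_simps)
    then have "?p u \<in> orthant"
      using convexD_alt[OF convex_orthant assms(2,3), of u] u by simp
    from min[OF this] have "- u * (w \<bullet> (x - y)) \<le> h (?p u) - h y" by (simp add: algebra_simps)
    then show "- (w \<bullet> (x - y)) \<le> (h (?p u) - h y) / u"
      using u by (simp add: pos_le_divide_eq mult.commute)
  qed simp
  ultimately have "- (w \<bullet> (x - y)) \<le> grad h y \<bullet> (x - y)"
    by (intro tendsto_lowerbound[OF _ _ trivial_limit_at_right_real])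
  then show ?thesis by (simp add: inner_add_left)
qed

lemma interior_orthantI:
  fixes z :: "real ^ 'm::finite"
  assumes "\<And>i. 0 < z $ i"
  shows "z \<in> interior orthant"
proof (rule interiorI[of "{x. \<forall>i. 0 < x $ i}"])
  have "{x :: real ^ 'm. \<forall>i. 0 < x $ i} = (\<Inter>i. {x. 0 < x $ i})" by auto
  also have "open \<dots>"
    by (intro open_INT ballI open_Collect_less continuous_intros) simp
  finally show "open {x :: real ^ 'm. \<forall>i. 0 < x $ i}" .
qed (use assms in \<open>auto simp: less_eq_vec_def less_imp_le\<close>)

lemma differentiable_interior_orthant:
  fixes h :: "real ^ 'm::finite \<Rightarrow> real"
  assumes "h differentiable_on interior orthant" "z \<in> interior orthant"
  shows "h differentiable (at z within orthant)"
proof -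
  have "h differentiable (at z)"
    using assms by (metis at_within_open differentiable_on_def open_interior)
  then show ?thesis by (rule differentiable_at_withinI)
qed

text \<open>At a minimiser \<open>y\<close> on the boundary, the gradients at \<open>y + s 1\<close> would stay bounded
  as \<open>s\<close> tends to \<open>0\<close>: monotonicity along the ray bounds them from below in the direction
  \<open>1\<close>, and the values at the fixed points \<open>y + 1 \<plusminus> axis i (1/2)\<close> bound each component.\<close>

lemma essentially_smooth_minimizer_interior:
  fixes h :: "real ^ 'm::finite \<Rightarrow> real"
  assumes h: "essentially_smooth h" "strongly_convex \<sigma> h" "0 < \<sigma>" and y: "y \<in> orthant"
    and min: "\<And>\<nu>. \<nu> \<in> orthant \<Longrightarrow> w \<bullet> y + h y \<le> w \<bullet> \<nu> + h \<nu>"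
  shows "y \<in> interior orthant"
proof (rule ccontr)
  assume "y \<notin> interior orthant"
  then have "y \<in> frontier orthant"
    using y closure_subset unfolding frontier_def by fastforce
  then have lim: "filterlim (\<lambda>z. norm (grad h z)) at_top (at y within interior orthant)"
    using h(1) by (simp add: essentially_smooth_def)
  have dif: "h differentiable_on interior orthant" using h(1) by (simp add: essentially_smooth_def)
  let ?z = "\<lambda>s::real. y + s *\<^sub>R 1"
  have y0: "0 \<le> y $ i" for i using y by (simp add: less_eq_vec_def)
  have zint: "?z s \<in> interior orthant" if "0 < s" for s
    using that y0 by (intro interior_orthantI) (simp add: add_nonneg_pos)
  have "filterlim ?z (at y within interior orthant) (at_right 0)"
  proof -
    have "(?z \<longlongrightarrow> y + 0 *\<^sub>R 1) (at_right 0)" by (intro tendsto_intros)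
    moreover have "\<forall>\<^sub>F s in at_right 0. ?z s \<in> interior orthant \<and> ?z s \<noteq> y"
      unfolding eventually_at_right_field by (intro exI[of _ 1]) (use zint in auto)
    ultimately show ?thesis by (simp add: filterlim_at)
  qed
  from filterlim_compose[OF lim this]
  have lim': "filterlim (\<lambda>s. norm (grad h (?z s))) at_top (at_right 0)" .
  let ?P = "\<lambda>i \<epsilon>. y + 1 + axis i \<epsilon> :: real ^ 'm"
  define C where "C = Max ((\<lambda>(i, \<epsilon>). w \<bullet> ?P i \<epsilon> + h (?P i \<epsilon>) - (w \<bullet> y + h y)) ` (UNIV \<times> {1/2, -1/2}))"
  have C: "w \<bullet> ?P i \<epsilon> + h (?P i \<epsilon>) - (w \<bullet> y + h y) \<le> C" if "\<epsilon> \<in> {1/2, -1/2}" for i \<epsilon>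
    unfolding C_def using that by (intro Max_ge) auto
  have bound: "norm (grad h (?z s)) \<le> (\<Sum>i\<in>(UNIV :: 'm set). 2 * C) + norm w" if s: "0 < s" "s < 1" for s
  proof -
    let ?g = "w + grad h (?z s)"
    have zs: "?z s \<in> orthant" using zint[OF s(1)] interior_subset by blast
    \<comment> \<open>Nonnegativity of the Bregman divergence makes \<open>?g\<close> a subgradient
      of \<open>h\<close> plus the linear function \<open>w\<close> at \<open>?z s\<close>.\<close>
    have sub: "?g \<bullet> (\<nu> - ?z s) \<le> w \<bullet> \<nu> + h \<nu> - (w \<bullet> ?z s + h (?z s))" if "\<nu> \<in> orthant" for \<nu>
    proof -
      have "0 \<le> \<sigma> / 2 * (l1norm (\<nu> - ?z s))\<^sup>2" using h(3) by simp
      also have "\<dots> \<le> bregman h \<nu> (?z s)"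
        using differentiable_interior_orthant[OF dif zint[OF s(1)]] zs that h(2)
        by (intro bregman_lower_bound)
      finally show ?thesis by (simp add: bregman_def algebra_simps)
    qed
    have "?g \<bullet> (y - ?z s) \<le> 0" using sub[OF y] min[OF zs] by linarith
    then have one: "0 \<le> ?g \<bullet> 1" using s(1) by (simp add: zero_le_mult_iff)
    have comp: "\<bar>?g $ i\<bar> \<le> 2 * C" for i
    proof -
      \<comment> \<open>The sign makes the pairing with \<open>?g\<close> equal to half the absolute
        value of its component; the size 1/2 keeps \<open>?P i \<epsilon>\<close> in the
        orthant.\<close>
      define \<epsilon> :: real where "\<epsilon> = (if 0 \<le> ?g $ i then 1/2 else -1/2)"
      have P: "?P i \<epsilon> \<in> orthant"
        using y0 by (auto simp: less_eq_vec_def axis_def \<epsilon>_def intro: add_increasing)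
      have "?g \<bullet> (?P i \<epsilon> - ?z s) = (1 - s) * (?g \<bullet> 1) + ?g \<bullet> axis i \<epsilon>"
        by (simp add: inner_diff_right inner_add_right algebra_simps del: inner_add_left)
      also have "?g \<bullet> axis i \<epsilon> = \<bar>?g $ i\<bar> / 2"
        by (cases "0 \<le> ?g $ i") (simp_all add: inner_axis \<epsilon>_def field_simps)
      finally have "\<bar>?g $ i\<bar> / 2 \<le> ?g \<bullet> (?P i \<epsilon> - ?z s)"
        using one s by simp
      also have "\<dots> \<le> w \<bullet> ?P i \<epsilon> + h (?P i \<epsilon>) - (w \<bullet> ?z s + h (?z s))" by (rule sub[OF P])
      also have "\<dots> \<le> w \<bullet> ?P i \<epsilon> + h (?P i \<epsilon>) - (w \<bullet> y + h y)" using min[OF zs] by simp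
      also have "\<dots> \<le> C" by (rule C) (auto simp: \<epsilon>_def)
      finally show ?thesis by simp
    qed
    have "norm (grad h (?z s)) \<le> norm ?g + norm w"
      using norm_triangle_ineq4[of ?g w] by simp
    moreover have "norm ?g \<le> (\<Sum>i\<in>(UNIV :: 'm set). 2 * C)"
      by (rule order_trans[OF norm_le_l1_cart sum_mono]) (use comp in simp)
    ultimately show ?thesis by linarith
  qed
  have "\<forall>\<^sub>F s in at_right 0. (\<Sum>i\<in>(UNIV :: 'm set). 2 * C) + norm w + 1 \<le> norm (grad h (?z s))"
    using lim' unfolding filterlim_at_top by blast
  then obtain b where b: "0 < b" "\<And>s. 0 < s \<Longrightarrow> s < b \<Longrightarrow>
      (\<Sum>i\<in>(UNIV :: 'm set). 2 * C) + norm w + 1 \<le> norm (grad h (?z s))"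
    unfolding eventually_at_right_field by auto
  define s where "s = min b 1 / 2"
  have s: "0 < s" "s < b" "s < 1" using b(1) by (auto simp: s_def)
  from b(2)[OF s(1,2)] bound[OF s(1,3)] show False by linarith
qed

text \<open>An essentially smooth \<open>h\<close> may lack derivatives on the boundary, but then
  the step ends in the interior. Hence \<open>grad\<close> is a genuine derivative wherever the next
  step starts.\<close>

lemma mirror_step_differentiable:
  assumes "reference_function \<sigma> h" "0 < \<eta>"
    "is_arg_min (mirror_objective \<eta> h g \<mu>) (\<lambda>\<nu>. \<nu> \<in> orthant) \<mu>'"
  shows "h differentiable (at \<mu>' within orthant)"
proof (cases "h differentiable_on orthant")
  case True
  then show ?thesis using assms(3) by (auto simp: differentiable_on_def is_arg_min_def)
next
  case False
  then have h: "essentially_smooth h" "strongly_convex \<sigma> h" "0 < \<sigma>"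
    using assms(1) by (auto simp: reference_function_def)
  have "\<mu>' \<in> interior orthant"
    by (rule essentially_smooth_minimizer_interior[OF h])
      (use assms in \<open>auto simp: is_arg_min_def intro: minimizer_linear_perturbation\<close>)
  then show ?thesis
    using h(1) by (intro differentiable_interior_orthant) (auto simp: essentially_smooth_def)
qed

text \<open>The first-order condition at \<open>\<mu>'\<close> is tested in the direction of
  \<open>\<nu>\<close>; its gradient terms combine into three Bregman divergences.\<close>

lemma mirror_step_three_point:
  assumes "reference_function \<sigma> h" "0 < \<eta>"
    "is_arg_min (mirror_objective \<eta> h g \<mu>) (\<lambda>\<nu>. \<nu> \<in> orthant) \<mu>'" "\<nu> \<in> orthant"
  shows "\<eta> * (g \<bullet> (\<mu>' - \<nu>)) \<le> bregman h \<nu> \<mu> - bregman h \<nu> \<mu>' - bregman h \<mu>' \<mu>"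
proof -
  have "0 \<le> (\<eta> *\<^sub>R g - grad h \<mu> + grad h \<mu>') \<bullet> (\<nu> - \<mu>')"
    using assms by (intro minimizer_first_order mirror_step_differentiable[OF assms(1-3)]
        minimizer_linear_perturbation[OF assms(2,3)]) (auto simp: is_arg_min_def)
  then show ?thesis by (simp add: bregman_def algebra_simps)
qed

text \<open>The three-point inequality for \<open>\<mu>'\<close> and the minimality of
  \<open>\<mu>''\<close> cancel to \<open>bregman h \<mu>'' \<mu>' \<le> 0\<close>, and strong
  convexity concludes.\<close>

lemma mirror_step_unique:
  assumes h: "reference_function \<sigma> h" and \<eta>: "0 < \<eta>"
    and min: "is_arg_min (mirror_objective \<eta> h g \<mu>) (\<lambda>\<nu>. \<nu> \<in> orthant) \<mu>'"
    "is_arg_min (mirror_objective \<eta> h g \<mu>) (\<lambda>\<nu>. \<nu> \<in> orthant) \<mu>''"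
  shows "\<mu>' = \<mu>''"
proof -
  have \<sigma>: "0 < \<sigma>" "strongly_convex \<sigma> h" using h by (auto simp: reference_function_def)
  have or: "\<mu>' \<in> orthant" "\<mu>'' \<in> orthant" using min by (auto simp: is_arg_min_def)
  have "\<eta> * (g \<bullet> (\<mu>' - \<mu>'')) \<le> bregman h \<mu>'' \<mu> - bregman h \<mu>'' \<mu>' - bregman h \<mu>' \<mu>"
    by (rule mirror_step_three_point[OF h \<eta> min(1) or(2)])
  moreover have "bregman h \<mu>'' \<mu> - bregman h \<mu>' \<mu> \<le> \<eta> * (g \<bullet> (\<mu>' - \<mu>''))"
    using minimizer_linear_perturbation[OF \<eta> min(2) or(1)] by (simp add: bregman_def algebra_simps)
  moreover have "\<sigma> / 2 * (l1norm (\<mu>'' - \<mu>'))\<^sup>2 \<le> bregman h \<mu>'' \<mu>'"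
    by (rule bregman_lower_bound[OF \<sigma>(2) mirror_step_differentiable[OF h \<eta> min(1)] or(2,1)])
  ultimately have "\<sigma> * (l1norm (\<mu>'' - \<mu>'))\<^sup>2 \<le> 0" by linarith
  then show ?thesis using \<sigma>(1) by (simp add: mult_le_0_iff l1norm_eq_0)
qed

text \<open>By uniqueness of the dual step, a price is a function of the past. This later makes the
  price at the start of a block independent of that block.\<close>

lemma iterates_agree:
  assumes "reference_function \<sigma> h" "0 < \<eta>"
    "mirror_descent_run T \<rho> \<eta> h \<mu>1 \<gamma> xt x B \<mu>" "mirror_descent_run T \<rho> \<eta> h \<mu>1 \<gamma>' xt' x' B' \<mu>'"
    "n \<le> T" "\<And>s. s < n \<Longrightarrow> \<gamma> s = \<gamma>' s" "\<And>s. s < n \<Longrightarrow> xt s = xt' s"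
  shows "\<mu> n = \<mu>' n"
  using assms(5-7)
proof (induction n)
  case 0
  then show ?case using assms(3,4) by (simp add: mirror_descent_run_def)
next
  case (Suc n)
  then have "\<mu> n = \<mu>' n" "\<gamma> n = \<gamma>' n" "xt n = xt' n" "n < T" by auto
  then show ?case
    using assms(3,4) by (intro mirror_step_unique[OF assms(1,2)]) (auto simp: mirror_descent_run_def)
qed

subsection \<open>Stopped rewards\<close>

definition dual_value :: "('d::finite, 'm::finite) request \<Rightarrow> real ^ 'm \<Rightarrow> real" where
  "dual_value r \<nu> = (SUP z\<in>actions r. lagrangian r \<nu> z)"

locale allocation =
  fixes S :: "('d::finite, 'm::finite) request set" and \<rho> :: "real ^ 'm" and F b \<rho>min \<rho>max :: real
  assumes wf: "r \<in> S \<Longrightarrow> well_formed r"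
    and bounded: "bounded_requests S F b"
    and \<rho>min_pos: "0 < \<rho>min" and \<rho>min_le: "\<rho>min \<le> \<rho> $ j" and le_\<rho>max: "\<rho> $ j \<le> \<rho>max"
    and \<rho>min_attained: "\<exists>j. \<rho> $ j = \<rho>min"
begin

text \<open>Smaller than the bound \<open>b + \<rho>max\<close> of the theorem; the difference pays for the block in
  which the resources run out.\<close>

definition subgrad_bound :: real where "subgrad_bound = max b \<rho>max"

text \<open>The function \<open>d\<^sub>t(\<nu>)\<close> of the introduction: one request's share of
  the Lagrangian dual of the hindsight problem, with the budget split evenly over time.\<close>

definition price_value :: "('d, 'm) request \<Rightarrow> real ^ 'm \<Rightarrow> real" where
  "price_value r \<nu> = dual_value r \<nu> + \<rho> \<bullet> \<nu>"

lemma F_nonneg: "0 \<le> F" and b_nonneg: "0 \<le> b"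
  using bounded by (auto simp: bounded_requests_def)

lemma \<rho>_pos: "0 < \<rho> $ j"
  using \<rho>min_pos \<rho>min_le by (rule less_le_trans)

lemma \<rho>max_pos: "0 < \<rho>max"
  using \<rho>_pos le_\<rho>max by (rule less_le_trans)

lemma \<rho>_nonneg: "0 \<le> \<rho>"
  using \<rho>_pos by (simp add: less_eq_vec_def less_imp_le)

lemma request_bounds:
  assumes "r \<in> S" "z \<in> actions r"
  shows "0 \<le> reward r z" "reward r z \<le> F" "0 \<le> consumption r z" "consumption r z $ i \<le> b"
proof -
  have "infnorm (consumption r z) \<le> b" using assms bounded by (auto simp: bounded_requests_def)
  with component_le_infnorm_cart[of "consumption r z" i] show "consumption r z $ i \<le> b" by linarith
qed (use assms bounded in \<open>auto simp: bounded_requests_def\<close>)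

lemma zero_action: "r \<in> S \<Longrightarrow> 0 \<in> actions r" "r \<in> S \<Longrightarrow> consumption r 0 = 0"
  using wf by (auto simp: well_formed_def)

lemma lagrangian_le:
  assumes "r \<in> S" "z \<in> actions r" "\<nu> \<in> orthant"
  shows "lagrangian r \<nu> z \<le> reward r z" "lagrangian r \<nu> z \<le> F"
proof -
  have "0 \<le> \<nu> \<bullet> consumption r z"
    using assms request_bounds(3) by (intro inner_nonneg_orthant) auto
  then show "lagrangian r \<nu> z \<le> reward r z" by (simp add: lagrangian_def)
  with request_bounds(2)[OF assms(1,2)] show "lagrangian r \<nu> z \<le> F" by simp
qed

lemma lagrangian_le_dual_value:
  assumes "r \<in> S" "z \<in> actions r" "\<nu> \<in> orthant"
  shows "lagrangian r \<nu> z \<le> dual_value r \<nu>"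
  unfolding dual_value_def using assms
  by (intro cSUP_upper) (auto intro!: bdd_aboveI2 lagrangian_le)

lemma dual_value_arg_max:
  assumes "r \<in> S" "\<nu> \<in> orthant" "is_arg_max (lagrangian r \<nu>) (\<lambda>z. z \<in> actions r) z"
  shows "dual_value r \<nu> = lagrangian r \<nu> z"
  unfolding dual_value_def using assms(3)
  by (intro cSup_eq_maximum) (auto simp: is_arg_max_def not_less)

lemma dual_value_attained:
  assumes "r \<in> S" "\<nu> \<in> orthant"
  obtains z where "z \<in> actions r" "dual_value r \<nu> = lagrangian r \<nu> z"
proof -
  obtain z where z: "is_arg_max (lagrangian r \<nu>) (\<lambda>z. z \<in> actions r) z"
    using bounded assms unfolding bounded_requests_def by blast
  show thesis
    by (rule that[OF _ dual_value_arg_max[OF assms z]]) (use z in \<open>simp add: is_arg_max_def\<close>)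
qed

lemma dual_value_nonneg:
  assumes "r \<in> S" "\<nu> \<in> orthant"
  shows "0 \<le> dual_value r \<nu>"
proof -
  have "0 \<le> lagrangian r \<nu> 0"
    using request_bounds(1)[OF assms(1)] zero_action assms by (simp add: lagrangian_def)
  also have "\<dots> \<le> dual_value r \<nu>" using assms zero_action by (intro lagrangian_le_dual_value) auto
  finally show ?thesis .
qed

lemma dual_value_le:
  assumes "r \<in> S" "\<nu> \<in> orthant"
  shows "dual_value r \<nu> \<le> F"
  using assms dual_value_attained lagrangian_le(2) by metis

lemma reward_le_dual_value:
  assumes "r \<in> S" "z \<in> actions r" "\<nu> \<in> orthant"
  shows "reward r z \<le> dual_value r \<nu> + \<nu> \<bullet> consumption r z"
  using lagrangian_le_dual_value[OF assms] by (simp add: lagrangian_def)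

lemma subgrad_bound_pos: "0 < subgrad_bound"
  using \<rho>max_pos by (simp add: subgrad_bound_def)

text \<open>Resources and consumption are both nonnegative, so each component lies between
  \<open>- b\<close> and \<open>\<rho>max\<close>; hence a maximum rather than a sum.\<close>

lemma subgradient_le:
  assumes "r \<in> S" "z \<in> actions r"
  shows "\<bar>(\<rho> - consumption r z) $ i\<bar> \<le> subgrad_bound"
  using request_bounds(3)[OF assms] request_bounds(4)[OF assms, of i] le_\<rho>max[of i] \<rho>_pos[of i]
  by (auto simp: subgrad_bound_def less_eq_vec_def)
     (smt (verit))

text \<open>A maximiser \<open>z\<close> for \<open>\<nu>\<close> also competes in the maximum for
  \<open>\<nu>'\<close>, so \<open>\<rho> - consumption r z\<close> is a subgradient at
  \<open>\<nu>\<close>.\<close>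

lemma price_value_lipschitz:
  assumes "r \<in> S" "\<nu> \<in> orthant" "\<nu>' \<in> orthant"
  shows "price_value r \<nu> \<le> price_value r \<nu>' + subgrad_bound * l1norm (\<nu> - \<nu>')"
proof -
  obtain z where z: "z \<in> actions r" "dual_value r \<nu> = lagrangian r \<nu> z"
    using dual_value_attained assms by metis
  have "price_value r \<nu> - price_value r \<nu>' \<le> (\<rho> - consumption r z) \<bullet> (\<nu> - \<nu>')"
    using z lagrangian_le_dual_value[OF assms(1) z(1) assms(3)]
    by (simp add: price_value_def lagrangian_def algebra_simps inner_commute)
  also have "\<dots> \<le> subgrad_bound * l1norm (\<nu> - \<nu>')"
    by (intro inner_le_l1norm subgradient_le assms z)
  finally show ?thesis by simp
qed

lemma total_reward_le:
  assumes "\<And>t. t < T \<Longrightarrow> \<gamma> t \<in> S" "\<And>t. t < T \<Longrightarrow> x t \<in> actions (\<gamma> t)"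
  shows "total_reward T \<gamma> x \<le> real T * F"
  unfolding total_reward_def using sum_mono[of "{..<T}" "\<lambda>t. reward (\<gamma> t) (x t)" "\<lambda>_. F"]
    request_bounds(2) assms by simp

lemma run_action:
  assumes "mirror_descent_run T \<rho> \<eta> h \<mu>1 \<gamma> xt x B \<mu>" "t < T" "\<gamma> t \<in> S"
  shows "x t \<in> actions (\<gamma> t)"
  using assms zero_action by (auto simp: mirror_descent_run_def is_arg_max_def)

lemma total_reward_nonneg:
  assumes "\<And>t. t < T \<Longrightarrow> \<gamma> t \<in> S" "\<And>t. t < T \<Longrightarrow> x t \<in> actions (\<gamma> t)"
  shows "0 \<le> total_reward T \<gamma> x"
  unfolding total_reward_def using assms request_bounds(1) by (intro sum_nonneg) auto

text \<open>Always taking the zero action is feasible, so the supremum is over a nonempty set. For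
  weak duality, the budget caps the total consumption priced at \<open>\<nu>\<close>.\<close>

lemma
  assumes \<gamma>: "\<And>t. t < T \<Longrightarrow> \<gamma> t \<in> S"
  shows hindsight_opt_nonneg: "0 \<le> hindsight_opt T \<rho> \<gamma>"
    and hindsight_opt_le: "hindsight_opt T \<rho> \<gamma> \<le> real T * F"
    and weak_duality: "\<nu> \<in> orthant \<Longrightarrow> hindsight_opt T \<rho> \<gamma> \<le> (\<Sum>t<T. price_value (\<gamma> t) \<nu>)"
proof -
  define X where "X = {x. (\<forall>t<T. x t \<in> actions (\<gamma> t)) \<and>
                (\<Sum>t<T. consumption (\<gamma> t) (x t)) \<le> real T *\<^sub>R \<rho>}"
  have "(\<Sum>t<T. consumption (\<gamma> t) 0) = 0"
    using zero_action(2) \<gamma> by (intro sum.neutral) auto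
  moreover have "0 \<le> real T *\<^sub>R \<rho>" using \<rho>_nonneg by (simp add: less_eq_vec_def)
  ultimately have X0: "(\<lambda>_. 0) \<in> X"
    using zero_action \<gamma> by (simp add: X_def)
  have le: "total_reward T \<gamma> x \<le> real T * F" if "x \<in> X" for x
    using that \<gamma> by (intro total_reward_le) (auto simp: X_def)
  have ne: "X \<noteq> {}" using X0 by blast
  have bdd: "bdd_above (total_reward T \<gamma> ` X)" by (rule bdd_aboveI2[OF le])
  show "hindsight_opt T \<rho> \<gamma> \<le> real T * F"
    unfolding hindsight_opt_def X_def[symmetric] by (rule cSUP_least[OF ne le])
  have "0 \<le> total_reward T \<gamma> (\<lambda>_. 0)"
    using zero_action \<gamma> by (intro total_reward_nonneg) auto
  also have "\<dots> \<le> hindsight_opt T \<rho> \<gamma>"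
    unfolding hindsight_opt_def X_def[symmetric] by (rule cSUP_upper[OF X0 bdd])
  finally show "0 \<le> hindsight_opt T \<rho> \<gamma>" .
  show "hindsight_opt T \<rho> \<gamma> \<le> (\<Sum>t<T. price_value (\<gamma> t) \<nu>)" if \<nu>: "\<nu> \<in> orthant"
    unfolding hindsight_opt_def X_def[symmetric]
  proof (rule cSUP_least[OF ne])
    fix x assume x: "x \<in> X"
    have "total_reward T \<gamma> x \<le> (\<Sum>t<T. dual_value (\<gamma> t) \<nu> + \<nu> \<bullet> consumption (\<gamma> t) (x t))"
      unfolding total_reward_def using x \<gamma> \<nu> by (intro sum_mono reward_le_dual_value) (auto simp: X_def)
    also have "\<dots> = (\<Sum>t<T. dual_value (\<gamma> t) \<nu>) + \<nu> \<bullet> (\<Sum>t<T. consumption (\<gamma> t) (x t))"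
      by (simp add: sum.distrib inner_sum_right)
    also have "\<nu> \<bullet> (\<Sum>t<T. consumption (\<gamma> t) (x t)) \<le> \<nu> \<bullet> (real T *\<^sub>R \<rho>)"
      using inner_nonneg_orthant[of \<nu> "real T *\<^sub>R \<rho> - (\<Sum>t<T. consumption (\<gamma> t) (x t))"] x \<nu>
      by (simp add: X_def inner_diff_right)
    finally show "total_reward T \<gamma> x \<le> (\<Sum>t<T. price_value (\<gamma> t) \<nu>)"
      by (simp add: price_value_def sum.distrib inner_commute)
  qed
qed

end

section \<open>Mirror descent regret along one fixed request sequence\<close>

locale allocation_run = allocation S \<rho> F b \<rho>min \<rho>max
  for S :: "('d::finite, 'm::finite) request set" and \<rho> :: "real ^ 'm" and F b \<rho>min \<rho>max :: real +
  fixes T :: nat and \<eta> \<sigma> :: real and h :: "real ^ 'm \<Rightarrow> real" and \<mu>1 :: "real ^ 'm" and C :: real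
    and \<gamma> :: "nat \<Rightarrow> ('d, 'm) request" and xt x :: "nat \<Rightarrow> real ^ 'd" and B \<mu> :: "nat \<Rightarrow> real ^ 'm"
  assumes reference: "reference_function \<sigma> h"
    and \<eta>_pos: "0 < \<eta>"
    and initial: "\<mu>1 \<in> orthant" "h differentiable (at \<mu>1 within orthant)"
    and C_zero: "bregman h 0 \<mu>1 \<le> C"
    and C_axis: "bregman h ((F / \<rho> $ j) *\<^sub>R axis j 1) \<mu>1 \<le> C"
    and requests: "t < T \<Longrightarrow> \<gamma> t \<in> S"
    and run: "mirror_descent_run T \<rho> \<eta> h \<mu>1 \<gamma> xt x B \<mu>"
begin

text \<open>Proposed maximisers count whether or not they are accepted, as they do in the
  subgradients; up to the first rejection this is the actual consumption.\<close>

definition demand :: "nat \<Rightarrow> real ^ 'm" where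
  "demand n = (\<Sum>t<n. consumption (\<gamma> t) (xt t))"

abbreviation "\<beta> \<equiv> subgrad_bound"

lemma \<sigma>_pos: "0 < \<sigma>" and sconv: "strongly_convex \<sigma> h"
  using reference by (auto simp: reference_function_def)

lemma run_0: "B 0 = real T *\<^sub>R \<rho>" "\<mu> 0 = \<mu>1"
  using run by (simp_all add: mirror_descent_run_def)

lemma run_step:
  assumes "t < T"
  shows "is_arg_max (lagrangian (\<gamma> t) (\<mu> t)) (\<lambda>z. z \<in> actions (\<gamma> t)) (xt t)"
    "x t = (if consumption (\<gamma> t) (xt t) \<le> B t then xt t else 0)"
    "B (Suc t) = B t - consumption (\<gamma> t) (x t)"
    "is_arg_min (mirror_objective \<eta> h (\<rho> - consumption (\<gamma> t) (xt t)) (\<mu> t)) (\<lambda>\<nu>. \<nu> \<in> orthant) (\<mu> (Suc t))"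
  using run assms by (simp_all add: mirror_descent_run_def)

lemma xt_action: "t < T \<Longrightarrow> xt t \<in> actions (\<gamma> t)"
  using run_step(1) by (simp add: is_arg_max_def)

lemma x_action: "t < T \<Longrightarrow> x t \<in> actions (\<gamma> t)"
  by (rule run_action[OF run _ requests])

lemma iterate_orthant: "t \<le> T \<Longrightarrow> \<mu> t \<in> orthant"
  using run_0 initial run_step(4) by (cases t) (auto simp: is_arg_min_def)

lemma iterate_differentiable: "t \<le> T \<Longrightarrow> h differentiable (at (\<mu> t) within orthant)"
  using run_0 initial mirror_step_differentiable[OF reference \<eta>_pos run_step(4)] by (cases t) auto

text \<open>For the step length, the three-point inequality at \<open>\<nu> = \<mu> t\<close> bounds
  the two divergences between consecutive iterates, together at least
  \<open>\<sigma> * n\<^sup>2\<close>, by \<open>\<eta> * (\<beta> * n)\<close>. For the regret,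
  completing the square absorbs this linear term into
  \<open>bregman h ?\<mu>' ?\<mu>\<close>.\<close>

lemma step_bounds:
  assumes t: "t < T"
  shows iterate_step: "l1norm (\<mu> (Suc t) - \<mu> t) \<le> \<eta> * \<beta> / \<sigma>"
    and regret_step: "\<nu> \<in> orthant \<Longrightarrow> (\<rho> - consumption (\<gamma> t) (xt t)) \<bullet> (\<mu> t - \<nu>)
        \<le> (bregman h \<nu> (\<mu> t) - bregman h \<nu> (\<mu> (Suc t))) / \<eta> + \<eta> * \<beta>\<^sup>2 / (2 * \<sigma>)"
proof -
  let ?g = "\<rho> - consumption (\<gamma> t) (xt t)" and ?\<mu> = "\<mu> t" and ?\<mu>' = "\<mu> (Suc t)"
  define n where "n = l1norm (?\<mu>' - ?\<mu>)"
  have n0: "0 \<le> n" by (simp add: n_def l1norm_nonneg)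
  have or: "?\<mu> \<in> orthant" "?\<mu>' \<in> orthant" using iterate_orthant t by auto
  note three = mirror_step_three_point[OF reference \<eta>_pos run_step(4)[OF t]]
  have g: "?g \<bullet> (?\<mu> - ?\<mu>') \<le> \<beta> * n"
    unfolding n_def l1norm_minus_commute[of ?\<mu>' ?\<mu>]
    using xt_action requests t by (intro inner_le_l1norm subgradient_le) auto
  have V: "\<sigma> / 2 * n\<^sup>2 \<le> bregman h ?\<mu>' ?\<mu>"
    unfolding n_def using iterate_differentiable t sconv or by (intro bregman_lower_bound) auto
  have V': "\<sigma> / 2 * n\<^sup>2 \<le> bregman h ?\<mu> ?\<mu>'"
    unfolding n_def l1norm_minus_commute[of ?\<mu>' ?\<mu>]
    using iterate_differentiable t sconv or by (intro bregman_lower_bound) auto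
  have "\<sigma> * n\<^sup>2 \<le> \<eta> * (?g \<bullet> (?\<mu> - ?\<mu>'))"
    using three[OF or(1)] V V' by (simp add: bregman_def[of h ?\<mu> ?\<mu>] inner_diff_right algebra_simps)
  also have "\<dots> \<le> \<eta> * (\<beta> * n)" using g \<eta>_pos by simp
  finally have "n * (\<sigma> * n) \<le> n * (\<eta> * \<beta>)" by (simp add: power2_eq_square algebra_simps)
  then have "n = 0 \<or> \<sigma> * n \<le> \<eta> * \<beta>" using n0 mult_le_cancel_left_pos[of n] by fastforce
  then show "l1norm (\<mu> (Suc t) - \<mu> t) \<le> \<eta> * \<beta> / \<sigma>"
    unfolding n_def[symmetric] using \<sigma>_pos \<eta>_pos subgrad_bound_pos
    by (auto simp: pos_le_divide_eq mult.commute)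
  assume \<nu>: "\<nu> \<in> orthant"
  have "0 \<le> (\<sigma> * n - \<eta> * \<beta>)\<^sup>2 / (2 * \<sigma>)" using \<sigma>_pos by simp
  also have "\<dots> = \<sigma> / 2 * n\<^sup>2 - \<eta> * (\<beta> * n) + \<eta> * (\<eta> * \<beta>\<^sup>2 / (2 * \<sigma>))"
    using \<sigma>_pos by (simp add: power2_eq_square field_simps)
  finally have sq: "\<eta> * (\<beta> * n) \<le> \<sigma> / 2 * n\<^sup>2 + \<eta> * (\<eta> * \<beta>\<^sup>2 / (2 * \<sigma>))" by simp
  have "\<eta> * (?g \<bullet> (?\<mu> - \<nu>)) = \<eta> * (?g \<bullet> (?\<mu> - ?\<mu>')) + \<eta> * (?g \<bullet> (?\<mu>' - \<nu>))"
    by (simp add: inner_diff_right algebra_simps)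
  also have "\<eta> * (?g \<bullet> (?\<mu> - ?\<mu>')) \<le> \<eta> * (\<beta> * n)" using g \<eta>_pos by simp
  finally have "\<eta> * (?g \<bullet> (?\<mu> - \<nu>)) \<le> \<eta> * ((bregman h \<nu> ?\<mu> - bregman h \<nu> ?\<mu>') / \<eta> + \<eta> * \<beta>\<^sup>2 / (2 * \<sigma>))"
    using three[OF \<nu>] V sq \<eta>_pos by (simp add: distrib_left)
  then show "?g \<bullet> (?\<mu> - \<nu>) \<le> (bregman h \<nu> ?\<mu> - bregman h \<nu> ?\<mu>') / \<eta> + \<eta> * \<beta>\<^sup>2 / (2 * \<sigma>)"
    using \<eta>_pos by simp
qed

lemma iterate_drift: "s + n \<le> T \<Longrightarrow> l1norm (\<mu> (s + n) - \<mu> s) \<le> real n * (\<eta> * \<beta> / \<sigma>)"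
proof (induction n)
  case (Suc n)
  have "l1norm (\<mu> (s + Suc n) - \<mu> s) \<le> l1norm (\<mu> (Suc (s + n)) - \<mu> (s + n)) + l1norm (\<mu> (s + n) - \<mu> s)"
    using l1norm_triangle by simp
  also have "\<dots> \<le> \<eta> * \<beta> / \<sigma> + real n * (\<eta> * \<beta> / \<sigma>)"
    using iterate_step[of "s + n"] Suc by (intro add_mono) auto
  finally show ?case by (simp only: of_nat_Suc distrib_right mult_1)
qed (simp add: l1norm_def)

text \<open>The divergences telescope, and the last one is dropped because it is
  nonnegative.\<close>

lemma regret:
  assumes "n \<le> T" "\<nu> \<in> orthant"
  shows "(\<Sum>t<n. (\<rho> - consumption (\<gamma> t) (xt t)) \<bullet> (\<mu> t - \<nu>))
    \<le> bregman h \<nu> \<mu>1 / \<eta> + real n * (\<eta> * \<beta>\<^sup>2 / (2 * \<sigma>))"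
proof -
  have "(\<Sum>t<n. (\<rho> - consumption (\<gamma> t) (xt t)) \<bullet> (\<mu> t - \<nu>))
      \<le> (\<Sum>t<n. (bregman h \<nu> (\<mu> t) - bregman h \<nu> (\<mu> (Suc t))) / \<eta> + \<eta> * \<beta>\<^sup>2 / (2 * \<sigma>))"
    using assms by (intro sum_mono regret_step) auto
  also have "\<dots> = (bregman h \<nu> \<mu>1 - bregman h \<nu> (\<mu> n)) / \<eta> + real n * (\<eta> * \<beta>\<^sup>2 / (2 * \<sigma>))"
    unfolding sum.distrib sum_divide_distrib[symmetric]
      sum_lessThan_telescope'[of "\<lambda>t. bregman h \<nu> (\<mu> t)"] by (simp add: run_0)
  also have "bregman h \<nu> (\<mu> n) \<ge> 0"
    by (rule order_trans[OF _ bregman_lower_bound[OF sconv iterate_differentiable]])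
      (use assms iterate_orthant \<sigma>_pos in auto)
  then have "(bregman h \<nu> \<mu>1 - bregman h \<nu> (\<mu> n)) / \<eta> \<le> bregman h \<nu> \<mu>1 / \<eta>"
    using \<eta>_pos by (simp add: divide_right_mono)
  finally show ?thesis by simp
qed

section \<open>The time at which the resources run out\<close>

lemma demand_mono:
  assumes "m \<le> n" "n \<le> T"
  shows "demand m \<le> demand n"
  unfolding demand_def less_eq_vec_def using assms request_bounds(3) xt_action requests
  by (auto intro!: sum_mono2 simp: less_eq_vec_def)

text \<open>By induction: while the demand fits the budget, the remaining resources are the budget
  minus the demand, so the next proposal passes the acceptance test.\<close>

lemma accepted:
  assumes "n \<le> T" "demand n \<le> real T *\<^sub>R \<rho>"
  shows "B n = real T *\<^sub>R \<rho> - demand n" "\<forall>t<n. x t = xt t"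
proof -
  have "B n = real T *\<^sub>R \<rho> - demand n \<and> (\<forall>t<n. x t = xt t)"
    using assms
  proof (induction n)
    case (Suc n)
    have "demand n \<le> real T *\<^sub>R \<rho>" using demand_mono[of n "Suc n"] Suc.prems by auto
    with Suc have IH: "B n = real T *\<^sub>R \<rho> - demand n" "\<forall>t<n. x t = xt t" by auto
    have dS: "demand (Suc n) = demand n + consumption (\<gamma> n) (xt n)" by (simp add: demand_def)
    then have "x n = xt n"
      using run_step(2)[of n] Suc.prems IH by (simp add: algebra_simps)
    then show ?case using run_step(3)[of n] Suc.prems IH dS by (auto simp: less_Suc_eq algebra_simps)
  qed (simp add: demand_def run_0)
  then show "B n = real T *\<^sub>R \<rho> - demand n" "\<forall>t<n. x t = xt t" by auto
qed

lemma accepted_reward_le: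
  assumes "n \<le> T" "demand n \<le> real T *\<^sub>R \<rho>"
  shows "(\<Sum>t<n. reward (\<gamma> t) (xt t)) \<le> total_reward T \<gamma> x"
proof -
  have "(\<Sum>t<n. reward (\<gamma> t) (xt t)) = (\<Sum>t<n. reward (\<gamma> t) (x t))"
    using accepted(2)[OF assms] by simp
  also have "\<dots> \<le> total_reward T \<gamma> x"
    unfolding total_reward_def using assms request_bounds(1) x_action requests by (intro sum_mono2) auto
  finally show ?thesis .
qed

text \<open>Time starts at 0: the proposals before \<open>stop\<close> are accepted, and proposal
  \<open>stop\<close> is the first one rejected, unless \<open>stop = T\<close>.\<close>

definition stop :: nat where
  "stop = Max {n. n \<le> T \<and> demand n \<le> real T *\<^sub>R \<rho>}"

lemma stop: "stop \<le> T" "demand stop \<le> real T *\<^sub>R \<rho>" "stop < T \<Longrightarrow> \<not> demand (Suc stop) \<le> real T *\<^sub>R \<rho>"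
proof -
  let ?A = "{n. n \<le> T \<and> demand n \<le> real T *\<^sub>R \<rho>}"
  have fin: "finite ?A" by simp
  have "0 \<in> ?A" using \<rho>_nonneg by (simp add: demand_def less_eq_vec_def)
  then have "stop \<in> ?A" unfolding stop_def using fin by (intro Max_in) auto
  then show "stop \<le> T" "demand stop \<le> real T *\<^sub>R \<rho>" by auto
  show "\<not> demand (Suc stop) \<le> real T *\<^sub>R \<rho>" if "stop < T"
    using Max_ge[OF fin, of "Suc stop"] that unfolding stop_def[symmetric] by auto
qed

lemma demand_le_iff:
  assumes "n \<le> T"
  shows "demand n \<le> real T *\<^sub>R \<rho> \<longleftrightarrow> n \<le> stop"
proof
  show "n \<le> stop" if "demand n \<le> real T *\<^sub>R \<rho>"
    unfolding stop_def using that assms by (intro Max_ge) auto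
  show "demand n \<le> real T *\<^sub>R \<rho>" if "n \<le> stop"
    using demand_mono[OF that stop(1)] stop(2) by order
qed

text \<open>Request \<open>stop\<close> makes the demand for some resource \<open>j\<close> exceed
  the budget, but takes at most \<open>b\<close> of it. Since at most \<open>T\<close> requests
  exceed \<open>real T * \<rho>min\<close>, one of them can take more than \<open>\<rho>min\<close>;
  \<open>drift_dominates_price\<close> relies on this.\<close>

lemma exhausted:
  assumes "stop < T"
  obtains j where "real T * \<rho> $ j - b \<le> demand stop $ j" "\<rho>min < b"
proof -
  obtain j where "\<not> demand (Suc stop) $ j \<le> real T * \<rho> $ j"
    using stop(3)[OF assms] by (auto simp: less_eq_vec_def)
  then have j: "real T * \<rho> $ j < demand (Suc stop) $ j" by simp
  have c: "consumption (\<gamma> t) (xt t) $ j \<le> b" if "t < T" for t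
    using that xt_action requests by (intro request_bounds)
  have "real T * \<rho>min \<le> real T * \<rho> $ j" by (intro mult_left_mono \<rho>min_le) simp
  also note j
  also have "demand (Suc stop) $ j \<le> (\<Sum>t<Suc stop. b)"
    unfolding demand_def sum_component using assms c by (intro sum_mono) auto
  also have "\<dots> \<le> real T * b" using assms b_nonneg by (auto intro!: mult_right_mono)
  finally have "\<rho>min < b" by (rule mult_left_less_imp_less) simp
  moreover have "real T * \<rho> $ j - b \<le> demand stop $ j"
    using j c[OF assms] by (simp add: demand_def)
  ultimately show thesis using that by blast
qed

lemma price_value_iterate:
  assumes "t < T"
  shows "price_value (\<gamma> t) (\<mu> t) = reward (\<gamma> t) (xt t) + (\<rho> - consumption (\<gamma> t) (xt t)) \<bullet> \<mu> t"
  using dual_value_arg_max[OF requests[OF assms] iterate_orthant run_step(1)] assms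
  by (simp add: price_value_def lagrangian_def inner_diff_left inner_diff_right inner_commute)

lemma stopped_reward:
  "(\<Sum>t<stop. price_value (\<gamma> t) (\<mu> t)) + F * (real T - real stop)
    \<le> total_reward T \<gamma> x + F * b / \<rho>min + C / \<eta> + real T * (\<eta> * \<beta>\<^sup>2 / (2 * \<sigma>))"
proof -
  let ?g = "\<lambda>t. \<rho> - consumption (\<gamma> t) (xt t)"
  have Fb: "0 \<le> F * b / \<rho>min" using F_nonneg b_nonneg \<rho>min_pos by simp
  \<comment> \<open>The comparison point is chosen so that its pairing with the subgradients pays
    \<open>F\<close> for each period after \<open>stop\<close>. Missing the budget of the exhausted
    resource by at most \<open>b\<close> leaves the error \<open>F * b / \<rho>min\<close>.\<close>
  obtain \<nu> where \<nu>: "\<nu> \<in> orthant" "bregman h \<nu> \<mu>1 \<le> C"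
    "(\<Sum>t<stop. ?g t) \<bullet> \<nu> \<le> F * b / \<rho>min - F * (real T - real stop)"
  proof (cases "stop < T")
    case False
    then show thesis using that[of 0] C_zero stop(1) Fb by simp
  next
    case True
    then obtain j where j: "real T * \<rho> $ j - b \<le> demand stop $ j" by (rule exhausted)
    let ?\<nu> = "(F / \<rho> $ j) *\<^sub>R axis j (1::real)"
    have "(\<Sum>t<stop. ?g t) \<bullet> ?\<nu> = (F / \<rho> $ j) * (real stop * \<rho> $ j - demand stop $ j)"
      by (simp add: inner_axis demand_def sum_subtractf of_nat_index)
    also have "\<dots> \<le> (F / \<rho> $ j) * (real stop * \<rho> $ j - (real T * \<rho> $ j - b))"
      using j F_nonneg \<rho>_pos[of j] by (intro mult_left_mono) auto
    also have "\<dots> = F * b / \<rho> $ j - F * (real T - real stop)"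
      using \<rho>_pos[of j] by (simp add: field_simps)
    also have "F * b / \<rho> $ j \<le> F * b / \<rho>min"
      using F_nonneg b_nonneg \<rho>min_pos \<rho>min_le[of j] by (intro divide_left_mono) auto
    finally have "(\<Sum>t<stop. ?g t) \<bullet> ?\<nu> \<le> F * b / \<rho>min - F * (real T - real stop)" by simp
    moreover have "?\<nu> \<in> orthant"
      using F_nonneg \<rho>_pos[of j] by (auto simp: less_eq_vec_def axis_def)
    ultimately show thesis using C_axis that by blast
  qed
  have "(\<Sum>t<stop. price_value (\<gamma> t) (\<mu> t)) = (\<Sum>t<stop. reward (\<gamma> t) (xt t)) + (\<Sum>t<stop. ?g t \<bullet> \<mu> t)"
    unfolding sum.distrib[symmetric] using stop(1) by (intro sum.cong price_value_iterate) auto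
  also have "(\<Sum>t<stop. ?g t \<bullet> \<mu> t) = (\<Sum>t<stop. ?g t \<bullet> (\<mu> t - \<nu>)) + (\<Sum>t<stop. ?g t) \<bullet> \<nu>"
    by (simp add: inner_sum_left sum.distrib[symmetric] inner_diff_right)
  also have "(\<Sum>t<stop. ?g t \<bullet> (\<mu> t - \<nu>)) \<le> bregman h \<nu> \<mu>1 / \<eta> + real stop * (\<eta> * \<beta>\<^sup>2 / (2 * \<sigma>))"
    by (rule regret[OF stop(1) \<nu>(1)])
  also have "bregman h \<nu> \<mu>1 / \<eta> \<le> C / \<eta>" using \<nu>(2) \<eta>_pos by (simp add: divide_right_mono)
  also have "real stop * (\<eta> * \<beta>\<^sup>2 / (2 * \<sigma>)) \<le> real T * (\<eta> * \<beta>\<^sup>2 / (2 * \<sigma>))"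
    using stop(1) \<eta>_pos \<sigma>_pos by (intro mult_right_mono) auto
  finally show ?thesis using \<nu>(3) accepted_reward_le[OF stop(1,2)] by simp
qed

end

subsection \<open>Comparison with block prices\<close>

lemma sum_blocks: "(\<Sum>t<N * q. f t) = (\<Sum>k<N. \<Sum>i<q. f (k * q + i :: nat))"
proof (induction N)
  case (Suc N)
  have "(\<Sum>t<n + q. f t) = (\<Sum>t<n. f t) + (\<Sum>i<q. f (n + i))" for n
    by (induction q) (auto simp: add.assoc)
  from this[of "N * q"] Suc show ?case by (simp add: add.commute)
qed simp

text \<open>\<open>t mod q\<close> is the age of the block price at time \<open>t\<close>; on
  average it is at most \<open>q / 2\<close>.\<close>

lemma sum_mod_le: "(\<Sum>t<N * q. real (t mod q)) \<le> real (N * q) * real q / 2"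
proof -
  have gauss: "(\<Sum>i<q. real i) \<le> real q * real q / 2"
    by (induction q) (auto simp: field_simps)
  have "(\<Sum>t<N * q. real (t mod q)) = (\<Sum>k<N. \<Sum>i<q. real i)"
    unfolding sum_blocks by (intro sum.cong) auto
  also have "\<dots> = real N * (\<Sum>i<q. real i)" by simp
  also have "\<dots> \<le> real N * (real q * real q / 2)" using gauss by (intro mult_left_mono) auto
  finally show ?thesis by simp
qed

text \<open>In the application \<open>r\<close> is the value \<open>\<rho> \<bullet> \<mu>\<^sub>t\<close> of a dual iterate, \<open>s = \<eta> T / \<sigma>\<close>, \<open>g s\<close> bounds the
  distance of the iterate from \<open>\<mu>1\<close>, and \<open>m + z\<close> is a lower bound for the distance of \<open>\<mu>1\<close> from the
  farther one of \<open>0\<close> and \<open>(F / p) e\<^sub>j\<close>, where \<open>p = \<rho>\<^sub>j\<close> is minimal.  The constant \<open>\<surd>2\<close> is only used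
  through \<open>1.4 \<le> \<surd>2\<close>.\<close>

lemma drift_dominates_price:
  fixes p R b m z F s g r :: real
  assumes p: "0 < p" "p \<le> R" "p \<le> b" and g: "g = max b R" and F: "0 < F"
    and m: "F / (2 * p) \<le> m" and z: "0 \<le> z" and s: "(m + z)\<^sup>2 / (2 * F) \<le> s"
    and r: "r \<le> F" "r \<le> p * m + R * z + R * (g * s)"
  shows "r \<le> s * (sqrt 2 * (b + R)\<^sup>2 - g\<^sup>2 / 2)"
proof -
  define \<kappa> where "\<kappa> = sqrt 2 * (b + R)\<^sup>2 - g\<^sup>2 / 2"
  define w where "w = m - F / (2 * p) + z"
  have w: "0 \<le> w" "z \<le> w" using m z by (auto simp: w_def)
  have "sqrt (1.4\<^sup>2) \<le> sqrt 2" by (intro real_sqrt_le_mono) (simp add: power2_eq_square)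
  then have "1.4 \<le> sqrt 2" by simp
  then have "1.4 * (b + R)\<^sup>2 \<le> sqrt 2 * (b + R)\<^sup>2" by (intro mult_right_mono) auto
  then have \<kappa>: "1.4 * (b + R)\<^sup>2 - g\<^sup>2 / 2 \<le> \<kappa>" by (simp add: \<kappa>_def)
  have pp: "p * p \<le> p * b" "p * p \<le> p * R" "p * p \<le> b * b" "p * p \<le> R * R" "p * b \<le> R * b" "p * R \<le> b * R" "p * R \<le> R * R"
    using p by (auto intro!: mult_mono)
  have p2: "0 < p * p" using p by simp
  have "F / (8 * p\<^sup>2) + w / (2 * p) = ((F / (2 * p))\<^sup>2 + 2 * (F / (2 * p)) * w) / (2 * F)"
    using p F by (simp add: power2_eq_square field_simps)
  also have "\<dots> \<le> (F / (2 * p) + w)\<^sup>2 / (2 * F)"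
    using F by (intro divide_right_mono) (auto simp: power2_sum)
  also have "F / (2 * p) + w = m + z" by (simp add: w_def)
  finally have s': "F / (8 * p\<^sup>2) + w / (2 * p) \<le> s" using s by simp
  moreover have s0: "0 \<le> F / (8 * p\<^sup>2)" "0 \<le> w / (2 * p)" using p F w by auto
  ultimately have s1: "F / (8 * p\<^sup>2) \<le> s" "0 \<le> s" by auto
  have "r \<le> s * \<kappa>"
  \<comment> \<open>For large \<open>\<kappa>\<close> the term \<open>F / (8 * p\<^sup>2)\<close> of
    \<open>s\<close> alone pays for \<open>r \<le> F\<close>; otherwise the second bound on
    \<open>r\<close> is used.\<close>
  proof (cases "8 * p\<^sup>2 \<le> \<kappa>")
    case True
    have "F = F / (8 * p\<^sup>2) * (8 * p\<^sup>2)" using p by simp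
    also have "\<dots> \<le> s * \<kappa>" using s1 True s0 by (intro mult_mono) auto
    finally show ?thesis using r(1) by simp
  next
    case False
    \<comment> \<open>If \<open>g = R > 2 * p\<close>, the lower bound on \<open>\<kappa>\<close>
      would be at least \<open>10.6 * p\<^sup>2\<close>, against the case assumption.\<close>
    have "g = R \<Longrightarrow> R \<le> 2 * p"
    proof (rule ccontr)
      assume gR: "g = R" and "\<not> R \<le> 2 * p"
      then have "2 * p * (2 * p) \<le> R * R" "2 * p * p \<le> R * b"
        using p by (intro mult_mono; simp)+
      with gR pp False \<kappa> p2 show False by (simp add: power2_eq_square algebra_simps)
    qed
    then consider "g = b" | "g = R" "R \<le> 2 * p" using g by linarith
    \<comment> \<open>The two inequalities match the two terms below \<open>s\<close>: multiplied by
      \<open>4 * (p * p)\<close> and \<open>2 * (p * R)\<close> these give \<open>F / 2\<close> and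
      \<open>R * w\<close>, while \<open>R * g\<close> is reserved for the drift.\<close>
    then have c: "4 * (p * p) + R * g \<le> \<kappa> \<and> 2 * (p * R) + R * g \<le> \<kappa>"
    proof cases
      case 1
      then show ?thesis using \<kappa> pp p2 by (simp add: power2_eq_square algebra_simps)
    next
      case 2
      have "R * R \<le> 2 * p * R" using 2 p by (intro mult_right_mono) auto
      then show ?thesis using 2 \<kappa> pp p2 by (simp add: power2_eq_square algebra_simps)
    qed
    have "p * m + R * z = F / 2 + p * (m - F / (2 * p)) + R * z" using p by (simp add: field_simps)
    also have "\<dots> \<le> F / 2 + R * (m - F / (2 * p)) + R * z"
      using p m z by (intro add_mono mult_right_mono) auto
    also have "\<dots> = F / (8 * p\<^sup>2) * (4 * (p * p)) + w / (2 * p) * (2 * (p * R))"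
      using p by (simp add: w_def power2_eq_square field_simps)
    also have "\<dots> \<le> F / (8 * p\<^sup>2) * (\<kappa> - R * g) + w / (2 * p) * (\<kappa> - R * g)"
      using c s0 by (intro add_mono mult_left_mono) auto
    also have "\<dots> = (F / (8 * p\<^sup>2) + w / (2 * p)) * (\<kappa> - R * g)" by (simp add: distrib_right)
    also have "\<dots> \<le> s * (\<kappa> - R * g)"
      using c p2 by (intro mult_right_mono[OF s']) auto
    finally show ?thesis using r(2) by (simp add: algebra_simps)
  qed
  then show ?thesis by (simp add: \<kappa>_def)
qed

section \<open>Paying for the block in which the resources run out\<close>

context allocation_run
begin

text \<open>\<open>real q * loss_bound\<close> is the \<open>C4\<close> term of the theorem minus
  the cost of the price drift inside the blocks.\<close>

definition loss_bound :: real where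
  "loss_bound = \<eta> * real T / \<sigma> * (sqrt 2 * (b + \<rho>max)\<^sup>2 - \<beta>\<^sup>2 / 2)"

lemma subgrad_bound_sq_le: "\<beta>\<^sup>2 \<le> (b + \<rho>max)\<^sup>2"
  using b_nonneg \<rho>max_pos by (intro power_mono) (auto simp: subgrad_bound_def)

lemma loss_bound_nonneg: "0 \<le> loss_bound"
proof -
  have "\<beta>\<^sup>2 / 2 \<le> 1 * (b + \<rho>max)\<^sup>2" using subgrad_bound_sq_le zero_le_power2[of \<beta>] by linarith
  also have "\<dots> \<le> sqrt 2 * (b + \<rho>max)\<^sup>2" by (intro mult_right_mono) auto
  finally show ?thesis unfolding loss_bound_def using \<eta>_pos \<sigma>_pos by (intro mult_nonneg_nonneg) auto
qed

text \<open>\<open>C\<close> dominates the divergences of 0 and of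
  \<open>(F / \<rho> $ j) *\<^sub>R axis j 1\<close> from \<open>\<mu>1\<close>; strong convexity is
  applied to the one farther from \<open>\<mu>1\<close>.\<close>

lemma C_lower_bound:
  "\<sigma> / 2 * (max (\<mu>1 $ j) (F / \<rho> $ j - \<mu>1 $ j) + (\<Sum>i\<in>UNIV - {j}. \<mu>1 $ i))\<^sup>2 \<le> C"
proof -
  let ?z = "\<Sum>i\<in>UNIV - {j}. \<mu>1 $ i"
  have m0: "0 \<le> \<mu>1 $ i" for i using initial(1) by (simp add: less_eq_vec_def)
  then have z0: "0 \<le> ?z" by (simp add: sum_nonneg)
  have lower: "\<sigma> / 2 * (l1norm (c *\<^sub>R axis j 1 - \<mu>1))\<^sup>2 \<le> bregman h (c *\<^sub>R axis j 1) \<mu>1" if "0 \<le> c" for c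
    using that initial by (intro bregman_lower_bound[OF sconv]) (auto simp: less_eq_vec_def axis_def)
  have norm: "l1norm (c *\<^sub>R axis j 1 - \<mu>1) = \<bar>c - \<mu>1 $ j\<bar> + ?z" for c
    unfolding l1norm_def
    by (subst sum.remove[of _ j]) (auto simp: axis_def m0 intro!: sum.cong)
  have le: "\<sigma> / 2 * y\<^sup>2 \<le> C" if "0 \<le> y" "y \<le> \<bar>c - \<mu>1 $ j\<bar> + ?z" "0 \<le> c"
      "bregman h (c *\<^sub>R axis j 1) \<mu>1 \<le> C" for y c
  proof -
    have "\<sigma> / 2 * y\<^sup>2 \<le> \<sigma> / 2 * (\<bar>c - \<mu>1 $ j\<bar> + ?z)\<^sup>2"
      using that \<sigma>_pos by (intro mult_left_mono power_mono) auto
    with lower[OF that(3)] that(4) norm show ?thesis by simp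
  qed
  show ?thesis
  proof (cases "\<mu>1 $ j \<le> F / \<rho> $ j - \<mu>1 $ j")
    case True
    with m0[of j] z0 F_nonneg \<rho>_pos[of j] show ?thesis by (intro le[OF _ _ _ C_axis[of j]]) auto
  next
    case False
    with m0[of j] z0 C_zero show ?thesis by (intro le[of _ 0]) auto
  qed
qed

text \<open>The hypothesis on \<open>C / \<eta>\<close> forces \<open>\<eta> * T / \<sigma>\<close>
  to be large when \<open>\<mu>1\<close> is far from a comparison point. The price at time
  \<open>t\<close> is at most that of \<open>\<mu>1\<close> plus the drift.\<close>

lemma price_le_drift:
  assumes "stop < T" "C / \<eta> < real T * F" "t \<le> T" "\<rho> \<bullet> \<mu> t < F"
  shows "\<rho> \<bullet> \<mu> t \<le> loss_bound"
proof -
  obtain j where j: "\<rho> $ j = \<rho>min" using \<rho>min_attained by blast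
  \<comment> \<open>The maximum is over two numbers with sum \<open>F / \<rho>min\<close>, so it is
    at least half of that. In the price of \<open>\<mu>1\<close>, coordinate \<open>j\<close> has
    weight \<open>\<rho>min\<close> and the others at most \<open>\<rho>max\<close>.\<close>
  define m where "m = max (\<mu>1 $ j) (F / \<rho>min - \<mu>1 $ j)"
  define z where "z = (\<Sum>i\<in>UNIV - {j}. \<mu>1 $ i)"
  have m0: "0 \<le> \<mu>1 $ i" for i using initial(1) by (simp add: less_eq_vec_def)
  have "0 \<le> \<rho> \<bullet> \<mu> t"
    using iterate_orthant[OF assms(3)] \<rho>_nonneg by (intro inner_nonneg_orthant) auto
  with assms(4) have F: "0 < F" by simp
  show ?thesis
    unfolding loss_bound_def
  proof (rule drift_dominates_price[OF \<rho>min_pos _ _ _ F])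
    show "\<rho>min \<le> \<rho>max" using j le_\<rho>max by metis
    show "\<rho>min \<le> b" using exhausted[OF assms(1)] by (metis less_imp_le)
    show "\<beta> = max b \<rho>max" by (simp add: subgrad_bound_def)
    show "F / (2 * \<rho>min) \<le> m"
      using \<rho>min_pos by (simp add: m_def field_simps max_def)
    show "0 \<le> z" using m0 by (simp add: z_def sum_nonneg)
    have "\<sigma> / 2 * (m + z)\<^sup>2 \<le> C" using C_lower_bound[of j] by (simp add: m_def z_def j)
    also have "C \<le> \<eta> * (real T * F)" using assms(2) \<eta>_pos by (simp add: field_simps)
    finally show "(m + z)\<^sup>2 / (2 * F) \<le> \<eta> * real T / \<sigma>"
      using \<sigma>_pos F by (simp add: field_simps)
    show "\<rho> \<bullet> \<mu> t \<le> F" using assms(4) by simp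
    have "\<rho> \<bullet> \<mu>1 = \<rho>min * \<mu>1 $ j + (\<Sum>i\<in>UNIV - {j}. \<rho> $ i * \<mu>1 $ i)"
      unfolding inner_vec_def by (subst sum.remove[of _ j]) (auto simp: j)
    also have "\<dots> \<le> \<rho>min * m + (\<Sum>i\<in>UNIV - {j}. \<rho>max * \<mu>1 $ i)"
      using \<rho>min_pos le_\<rho>max m0 by (intro add_mono sum_mono mult_right_mono mult_left_mono) (auto simp: m_def)
    finally have "\<rho> \<bullet> \<mu>1 \<le> \<rho>min * m + \<rho>max * z" by (simp add: z_def sum_distrib_left)
    moreover have "\<rho> \<bullet> (\<mu> t - \<mu>1) \<le> \<rho>max * (\<beta> * (\<eta> * real T / \<sigma>))"
    proof -
      have "\<rho> \<bullet> (\<mu> t - \<mu>1) \<le> \<rho>max * l1norm (\<mu> t - \<mu>1)"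
        using \<rho>_pos le_\<rho>max by (intro inner_le_l1norm) (simp add: abs_of_pos)
      also have "l1norm (\<mu> t - \<mu>1) \<le> real t * (\<eta> * \<beta> / \<sigma>)"
        using iterate_drift[of 0 t] assms(3) by (simp add: run_0)
      also have "\<dots> \<le> real T * (\<eta> * \<beta> / \<sigma>)"
        using assms(3) \<eta>_pos \<sigma>_pos subgrad_bound_pos by (intro mult_right_mono) auto
      finally show ?thesis using \<rho>max_pos by (simp add: field_simps)
    qed
    ultimately show "\<rho> \<bullet> \<mu> t \<le> \<rho>min * m + \<rho>max * z + \<rho>max * (\<beta> * (\<eta> * real T / \<sigma>))"
      by (simp add: inner_diff_right)
  qed
qed

text \<open>Once the price is at least \<open>F\<close> or the resources are exhausted before the block starts, the
  trivial bound \<open>F\<close> per period replaces the dual one.\<close>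

definition benchmark :: "nat \<Rightarrow> (nat \<Rightarrow> real ^ 'm) \<Rightarrow> nat \<Rightarrow> real" where
  "benchmark q v t =
    (if demand (t div q * q) \<le> real T *\<^sub>R \<rho> \<and> \<rho> \<bullet> \<mu> (t div q * q) < F
     then price_value (\<gamma> t) (v (t div q)) else F)"

text \<open>Two Lipschitz steps lead from \<open>v\<close> via the price at the block start to
  \<open>\<mu> t\<close>. If the benchmark is \<open>F\<close>, the demand still fits the budget, so
  it is the price at the block start that is at least \<open>F\<close>, and
  \<open>price_value\<close> is at least the price.\<close>

lemma benchmark_before_stop:
  assumes "t < stop" "v (t div q) \<in> orthant" "l1norm (v (t div q) - \<mu> (t div q * q)) \<le> \<epsilon>"
  shows "benchmark q v t \<le> price_value (\<gamma> t) (\<mu> t) + \<beta> * (real (t mod q) * (\<eta> * \<beta> / \<sigma>) + \<epsilon>)"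
proof -
  let ?s = "t div q * q"
  have T: "t < T" "?s \<le> T"
    using assms(1) stop(1) by (auto intro: order_trans[OF div_times_less_eq_dividend])
  have or: "\<mu> t \<in> orthant" "\<mu> ?s \<in> orthant" using iterate_orthant T by auto
  have "l1norm (\<mu> ?s - \<mu> t) \<le> real (t mod q) * (\<eta> * \<beta> / \<sigma>)"
    using iterate_drift[of ?s "t mod q"] T by (simp add: l1norm_minus_commute[of "\<mu> t"])
  then have drift: "\<beta> * l1norm (\<mu> ?s - \<mu> t) \<le> \<beta> * (real (t mod q) * (\<eta> * \<beta> / \<sigma>))"
    using subgrad_bound_pos by (intro mult_left_mono) auto
  have "\<beta> * l1norm (v (t div q) - \<mu> ?s) \<le> \<beta> * \<epsilon>" using assms(3) subgrad_bound_pos by simp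
  moreover have "0 \<le> \<beta> * \<epsilon>"
    using l1norm_nonneg assms(3) subgrad_bound_pos by (meson less_imp_le mult_nonneg_nonneg order_trans)
  moreover have "price_value (\<gamma> t) (v (t div q)) \<le> price_value (\<gamma> t) (\<mu> ?s) + \<beta> * l1norm (v (t div q) - \<mu> ?s)"
    and base: "price_value (\<gamma> t) (\<mu> ?s) \<le> price_value (\<gamma> t) (\<mu> t) + \<beta> * l1norm (\<mu> ?s - \<mu> t)"
    using requests[OF T(1)] assms(2) or by (auto intro!: price_value_lipschitz)
  moreover have "\<rho> \<bullet> \<mu> ?s \<le> price_value (\<gamma> t) (\<mu> ?s)"
    using dual_value_nonneg[OF requests[OF T(1)] or(2)] by (simp add: price_value_def)
  moreover have "demand ?s \<le> real T *\<^sub>R \<rho>"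
    using demand_le_iff[OF T(2)] assms(1) by (simp add: order_trans[OF div_times_less_eq_dividend])
  ultimately show ?thesis using drift unfolding benchmark_def by (simp add: distrib_left)
qed

text \<open>From \<open>stop\<close> on, a block price is in use only if its block started by
  \<open>stop\<close>, hence only in the block of \<open>stop\<close>. There the value exceeds
  \<open>F\<close> by at most the price at the block start, to which \<open>price_le_drift\<close>
  applies.\<close>

lemma benchmark_after_stop:
  assumes "stop \<le> t" "t < T" "C / \<eta> < real T * F" "v (t div q) \<in> orthant"
    "\<rho> \<bullet> v (t div q) \<le> \<rho> \<bullet> \<mu> (t div q * q)"
  shows "benchmark q v t \<le> F + (if t div q = stop div q
    then loss_bound else 0)"
proof (cases "demand (t div q * q) \<le> real T *\<^sub>R \<rho> \<and> \<rho> \<bullet> \<mu> (t div q * q) < F")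
  case True
  have s: "t div q * q \<le> T" using assms(2) by (intro order_trans[OF div_times_less_eq_dividend]) simp
  then have "t div q * q \<le> stop" using True demand_le_iff by blast
  then have "t div q \<le> stop div q"
    by (metis div_le_mono div_mult_self_is_m div_by_0 gr0I mult_is_0 order_refl)
  then have "t div q = stop div q" using div_le_mono[OF assms(1), of q] by simp
  moreover have "price_value (\<gamma> t) (v (t div q)) \<le> F + \<rho> \<bullet> \<mu> (t div q * q)"
    using dual_value_le[OF requests[OF assms(2)] assms(4)] assms(5) by (simp add: price_value_def)
  moreover have "\<rho> \<bullet> \<mu> (t div q * q) \<le> loss_bound"
    using assms True s by (intro price_le_drift) auto
  ultimately show ?thesis using True by (simp add: benchmark_def)
next
  case False
  then show ?thesis using loss_bound_nonneg by (auto simp: benchmark_def)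
qed

lemma sum_benchmark_le:
  assumes q: "q dvd T" "0 < q" and small: "C / \<eta> < real T * F"
    and v: "\<And>k. k < T div q \<Longrightarrow> v k \<in> orthant"
      "\<And>k. k < T div q \<Longrightarrow> l1norm (v k - \<mu> (k * q)) \<le> \<epsilon>"
      "\<And>k. k < T div q \<Longrightarrow> \<rho> \<bullet> v k \<le> \<rho> \<bullet> \<mu> (k * q)"
  shows "(\<Sum>t<T. benchmark q v t) \<le> total_reward T \<gamma> x + F * b / \<rho>min
    + (b + \<rho>max)\<^sup>2 / (2 * \<sigma>) * \<eta> * real T + C / \<eta>
    + sqrt 2 / \<sigma> * (b + \<rho>max)\<^sup>2 * real q * \<eta> * real T + real T * (\<beta> * \<epsilon>)"
proof -
  let ?a = "\<eta> * \<beta> / \<sigma>"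
  let ?K = "stop div q"
  let ?pv = "\<lambda>t. price_value (\<gamma> t) (\<mu> t)"
  obtain N where N: "T = N * q" using q(1) by (metis dvd_div_mult_self)
  then have G: "\<beta>\<^sup>2 * (real T * \<eta> / (2 * \<sigma>)) \<le> (b + \<rho>max)\<^sup>2 * (real T * \<eta> / (2 * \<sigma>))"
    using \<eta>_pos \<sigma>_pos subgrad_bound_sq_le by (intro mult_right_mono) auto
  have kq: "t div q < T div q" if "t < T" for t
    using that q by (simp add: N less_mult_imp_div_less)
  have \<epsilon>0: "0 \<le> \<epsilon>" if "t < T" for t
    using v(2)[OF kq[OF that]] l1norm_nonneg by (rule order_trans[rotated])
  have "(\<Sum>t<T. benchmark q v t) \<le> (\<Sum>t<T. (if t < stop then ?pv t else F)
      + \<beta> * (real (t mod q) * ?a + \<epsilon>) + (if t div q = ?K then loss_bound else 0))"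
  proof (rule sum_mono)
    fix t assume t: "t \<in> {..<T}"
    then have "0 \<le> \<beta> * (real (t mod q) * ?a + \<epsilon>)"
      using \<epsilon>0 subgrad_bound_pos \<eta>_pos \<sigma>_pos by simp
    then show "benchmark q v t \<le> (if t < stop then ?pv t else F)
        + \<beta> * (real (t mod q) * ?a + \<epsilon>) + (if t div q = ?K then loss_bound else 0)"
      using benchmark_before_stop[of t v q \<epsilon>] benchmark_after_stop[of t v q] kq[of t] v[of "t div q"]
        t small loss_bound_nonneg by (cases "t < stop") auto
  qed
  also have "\<dots> = (\<Sum>t<T. if t < stop then ?pv t else F) + (\<beta> * ?a) * (\<Sum>t<T. real (t mod q))
      + real T * (\<beta> * \<epsilon>) + (\<Sum>t<T. if t div q = ?K then loss_bound else 0)"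
    by (simp add: sum.distrib sum_distrib_left sum_divide_distrib algebra_simps)
  also have "(\<Sum>t<T. if t < stop then ?pv t else F) = (\<Sum>t<stop. ?pv t) + F * (real T - real stop)"
  proof -
    have "{..<T} \<inter> {t. t < stop} = {..<stop}" "{..<T} \<inter> - {t. t < stop} = {stop..<T}"
      using stop(1) by auto
    then show ?thesis using stop(1) by (simp add: sum.If_cases of_nat_diff)
  qed
  \<comment> \<open>At most \<open>q\<close> periods share a block with \<open>stop\<close>.\<close>
  also have "(\<Sum>t<T. if t div q = ?K then loss_bound else 0) \<le> real q * loss_bound"
  proof -
    have "(\<Sum>t<T. if t div q = ?K then loss_bound else 0) = real (card ({..<T} \<inter> {t. t div q = ?K})) * loss_bound"
      by (simp add: sum.If_cases)
    also have "card ({..<T} \<inter> {t. t div q = ?K}) \<le> card {?K * q..<?K * q + q}"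
    proof (rule card_mono)
      show "{..<T} \<inter> {t. t div q = ?K} \<subseteq> {?K * q..<?K * q + q}"
      proof
        fix t assume "t \<in> {..<T} \<inter> {t. t div q = ?K}"
        then have K: "?K = t div q" by simp
        show "t \<in> {?K * q..<?K * q + q}"
          unfolding K using dividend_less_div_times[OF q(2), of t] by (simp add: add.commute)
      qed
    qed simp
    finally show ?thesis using loss_bound_nonneg by (simp add: mult_right_mono)
  qed
  also have "(\<beta> * ?a) * (\<Sum>t<T. real (t mod q)) \<le> (\<beta> * ?a) * (real T * real q / 2)"
    using sum_mod_le[where N = N and q = q] subgrad_bound_pos \<eta>_pos \<sigma>_pos unfolding N
    by (intro mult_left_mono) auto
  \<comment> \<open>The subtracted term cancels the drift cost just obtained and leaves exactly the
    \<open>C4\<close> term.\<close>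
  also have "real q * loss_bound = sqrt 2 / \<sigma> * (b + \<rho>max)\<^sup>2 * real q * \<eta> * real T - (\<beta> * ?a) * (real T * real q / 2)"
    using \<sigma>_pos by (simp add: loss_bound_def power2_eq_square field_simps)
  finally show ?thesis using stopped_reward G \<sigma>_pos
    by (simp add: algebra_simps)
qed

end

subsection \<open>Expectation over periodic requests\<close>

lemma block_measurable:
  assumes "k < T div q"
  shows "block q k \<in> measurable (\<Pi>\<^sub>M t\<in>{..<T}. M) (\<Pi>\<^sub>M i\<in>{..<q}. M)"
proof -
  have "k * q + i < T" if "i < q" for i
  proof -
    have "k * q + i < Suc k * q" using that by simp
    also have "\<dots> \<le> T div q * q" using assms by (intro mult_right_mono) auto
    also have "\<dots> \<le> T" by simp
    finally show ?thesis .
  qed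
  then show ?thesis
    unfolding block_def by (intro measurable_restrict measurable_component_singleton) auto
qed

text \<open>\<open>u\<close> factors through the first \<open>k\<close> blocks, and these and block
  \<open>k\<close> are disjoint groups of independent variables.\<close>

lemma past_block_independent:
  fixes u :: "(nat \<Rightarrow> 'r) \<Rightarrow> real" and g :: "(nat \<Rightarrow> 'r) \<Rightarrow> real"
  assumes P: "P \<in> periodic_laws T M q" and q: "q dvd T" "0 < q" and k: "k < T div q"
    and u: "u \<in> borel_measurable (\<Pi>\<^sub>M t\<in>{..<T}. M)" "integrable P u"
    and past: "\<And>\<gamma> \<gamma>'. \<gamma> \<in> space P \<Longrightarrow> \<gamma>' \<in> space P \<Longrightarrow> (\<And>s. s < k * q \<Longrightarrow> \<gamma> s = \<gamma>' s) \<Longrightarrow> u \<gamma> = u \<gamma>'"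
    and g: "g \<in> borel_measurable (\<Pi>\<^sub>M i\<in>{..<q}. M)" "integrable P (\<lambda>\<gamma>. g (block q k \<gamma>))"
  shows "(\<integral>\<gamma>. u \<gamma> * g (block q k \<gamma>) \<partial>P) = (\<integral>\<gamma>. u \<gamma> \<partial>P) * (\<integral>\<gamma>. g (block q k \<gamma>) \<partial>P)"
    and "integrable P (\<lambda>\<gamma>. u \<gamma> * g (block q k \<gamma>))"
proof -
  let ?PT = "\<Pi>\<^sub>M t\<in>{..<T}. M" and ?PQ = "\<Pi>\<^sub>M i\<in>{..<q}. M"
  interpret prob_space P using P by (simp add: periodic_laws_def)
  have sets: "sets P = sets ?PT" using P by (simp add: periodic_laws_def)
  have spaceP: "space P = {..<T} \<rightarrow>\<^sub>E space M"
    using sets_eq_imp_space_eq[OF sets] by (simp add: space_PiM)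
  have N: "T div q * q = T" using q by simp
  have T: "k * q < T" using k q(2) by (metis N mult_less_cancel2)
  obtain \<gamma>0 where "\<gamma>0 \<in> space P" using not_empty by blast
  then have r0: "\<gamma>0 0 \<in> space M" using T by (auto simp: spaceP PiE_iff)
  \<comment> \<open>Reassembles a sequence from its first \<open>k\<close> blocks. Padding with a
    fixed request keeps the result in the sample space, where \<open>u\<close> can be
    evaluated.\<close>
  define flat where
    "flat \<omega> = (\<lambda>t\<in>{..<T}. if t < k * q then \<omega> (t div q) (t mod q) else \<gamma>0 0)" for \<omega> :: "nat \<Rightarrow> nat \<Rightarrow> 'r"
  have flat: "flat \<in> measurable (\<Pi>\<^sub>M i\<in>{..<k}. ?PQ) ?PT"
    unfolding flat_def
  proof (rule measurable_restrict)
    fix t assume "t \<in> {..<T}"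
    show "(\<lambda>\<omega>. if t < k * q then \<omega> (t div q) (t mod q) else \<gamma>0 0) \<in> measurable (\<Pi>\<^sub>M i\<in>{..<k}. ?PQ) M"
    proof (cases "t < k * q")
      case True
      then have "t div q < k" by (simp add: less_mult_imp_div_less)
      then have "(\<lambda>\<omega>. \<omega> (t div q)) \<in> measurable (\<Pi>\<^sub>M i\<in>{..<k}. ?PQ) ?PQ"
        by (intro measurable_component_singleton) auto
      moreover have "(\<lambda>\<omega>. \<omega> (t mod q)) \<in> measurable ?PQ M"
        using q(2) by (intro measurable_component_singleton) auto
      ultimately have "(\<lambda>\<omega>. \<omega> (t div q) (t mod q)) \<in> measurable (\<Pi>\<^sub>M i\<in>{..<k}. ?PQ) M"
        by (rule measurable_compose)
      then show ?thesis using True by simp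
    qed (use r0 in simp)
  qed
  let ?X = "\<lambda>\<gamma>. restrict (\<lambda>i. block q i \<gamma>) {..<k}" and ?Y = "\<lambda>\<gamma>. restrict (\<lambda>i. block q i \<gamma>) {k}"
  have uX: "u (flat (?X \<gamma>)) = u \<gamma>" if \<gamma>: "\<gamma> \<in> space P" for \<gamma>
  proof (rule past)
    show "flat (?X \<gamma>) \<in> space P"
      using \<gamma> r0 T by (auto simp: spaceP flat_def block_def PiE_iff less_mult_imp_div_less q(2))
    show "flat (?X \<gamma>) s = \<gamma> s" if "s < k * q" for s
      using that T q(2) by (simp add: flat_def block_def less_mult_imp_div_less)
  qed fact
  have ind: "indep_vars (\<lambda>_. ?PQ) (block q) {..<T div q}"
    using P by (simp add: periodic_laws_def)
  have gk: "(\<lambda>\<omega>. g (\<omega> k)) \<in> borel_measurable (\<Pi>\<^sub>M i\<in>{k}. ?PQ)"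
    by (rule measurable_compose[OF _ g(1)]) (rule measurable_component_singleton, simp)
  have "indep_var borel ((\<lambda>\<omega>. u (flat \<omega>)) \<circ> ?X) borel ((\<lambda>\<omega>. g (\<omega> k)) \<circ> ?Y)"
    using k gk by (intro indep_var_compose[OF indep_var_restrict[OF ind]] measurable_compose[OF flat u(1)]) auto
  then have ind': "indep_var borel (\<lambda>\<gamma>. u (flat (?X \<gamma>))) borel (\<lambda>\<gamma>. g (block q k \<gamma>))"
    by (simp add: comp_def)
  have int: "integrable P (\<lambda>\<gamma>. u (flat (?X \<gamma>)))"
    using u(2) by (subst Bochner_Integration.integrable_cong[OF refl uX]) auto
  have "(\<integral>\<gamma>. u (flat (?X \<gamma>)) * g (block q k \<gamma>) \<partial>P) = (\<integral>\<gamma>. u (flat (?X \<gamma>)) \<partial>P) * (\<integral>\<gamma>. g (block q k \<gamma>) \<partial>P)"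
    by (rule indep_var_lebesgue_integral[OF ind' int g(2)])
  then show "(\<integral>\<gamma>. u \<gamma> * g (block q k \<gamma>) \<partial>P) = (\<integral>\<gamma>. u \<gamma> \<partial>P) * (\<integral>\<gamma>. g (block q k \<gamma>) \<partial>P)"
    by (simp add: uX cong: Bochner_Integration.integral_cong)
  show "integrable P (\<lambda>\<gamma>. u \<gamma> * g (block q k \<gamma>))"
    using indep_var_integrable[OF ind' int g(2)]
    by (simp add: uX cong: Bochner_Integration.integrable_cong)
qed

context allocation
begin

text \<open>\<open>V k\<close> is a price for the \<open>k\<close>-th block chosen from the preceding blocks; \<open>None\<close> stands for
  the trivial per-period benchmark \<open>F\<close>.\<close>

lemma expected_benchmark:
  fixes V :: "nat \<Rightarrow> (nat \<Rightarrow> ('d, 'm) request) \<Rightarrow> (real ^ 'm) option"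
  assumes P: "P \<in> periodic_laws T M q" and M: "space M = S" and q: "q dvd T" "0 < q" and T: "0 < T"
    and dual: "\<And>\<nu>. \<nu> \<in> orthant \<Longrightarrow> (\<lambda>r. dual_value r \<nu>) \<in> borel_measurable M"
    and opt: "hindsight_opt T \<rho> \<in> borel_measurable (\<Pi>\<^sub>M t\<in>{..<T}. M)"
    and G: "finite G" "G \<subseteq> orthant"
    and V: "\<And>k \<gamma>. k < T div q \<Longrightarrow> \<gamma> \<in> space P \<Longrightarrow> V k \<gamma> \<in> insert None (Some ` G)"
    and V_measurable: "\<And>k v. k < T div q \<Longrightarrow> {\<gamma> \<in> space P. V k \<gamma> = Some v} \<in> sets P"
    and V_past: "\<And>k \<gamma> \<gamma>'. k < T div q \<Longrightarrow> \<gamma> \<in> space P \<Longrightarrow> \<gamma>' \<in> space P \<Longrightarrow>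
      (\<And>s. s < k * q \<Longrightarrow> \<gamma> s = \<gamma>' s) \<Longrightarrow> V k \<gamma> = V k \<gamma>'"
  defines "W \<equiv> \<lambda>\<gamma> t. case V (t div q) \<gamma> of None \<Rightarrow> F | Some v \<Rightarrow> price_value (\<gamma> t) v"
  shows "integrable P (\<lambda>\<gamma>. \<Sum>t<T. W \<gamma> t)"
    and "(\<integral>\<gamma>. hindsight_opt T \<rho> \<gamma> \<partial>P) \<le> (\<integral>\<gamma>. (\<Sum>t<T. W \<gamma> t) \<partial>P)"
    and "integrable P (hindsight_opt T \<rho>)"
proof -
  let ?PT = "\<Pi>\<^sub>M t\<in>{..<T}. M" and ?PQ = "\<Pi>\<^sub>M i\<in>{..<q}. M"
  interpret prob_space P using P by (simp add: periodic_laws_def)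
  have sets: "sets P = sets ?PT" using P by (simp add: periodic_laws_def)
  have spaceP: "space P = {..<T} \<rightarrow>\<^sub>E S"
    using sets_eq_imp_space_eq[OF sets] by (simp add: space_PiM M)
  have \<gamma>S: "\<gamma> t \<in> S" if "\<gamma> \<in> space P" "t < T" for \<gamma> t
    using that by (auto simp: spaceP PiE_iff)
  define N where "N = T div q"
  have N: "T = N * q" using q by (simp add: N_def)
  then have N0: "0 < N" using T by (cases N) auto
  define \<phi> where "\<phi> v \<omega> = (\<Sum>i<q. price_value (\<omega> i) v)" for v and \<omega> :: "nat \<Rightarrow> ('d, 'm) request"
  define E where "E k v = {\<gamma> \<in> space P. V k \<gamma> = Some v}" for k v
  define I where "I k v = indicat_real (E k v)" for k v
  have block_eq: "\<phi> v (block q k \<gamma>) = (\<Sum>i<q. price_value (\<gamma> (k * q + i)) v)" for v k \<gamma>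
    unfolding \<phi>_def block_def by (intro sum.cong) auto
  have \<phi>_sum: "(\<Sum>k<N. \<phi> v (block q k \<gamma>)) = (\<Sum>t<T. price_value (\<gamma> t) v)" for v \<gamma>
    unfolding block_eq N sum_blocks ..
  have bm: "block q k \<in> measurable P ?PQ" if "k < N" for k
    using block_measurable[of k T q M] that unfolding N_def measurable_cong_sets[OF sets refl] .
  have \<phi>m: "\<phi> v \<in> borel_measurable ?PQ" if "v \<in> orthant" for v
    unfolding \<phi>_def price_value_def using that dual
    by (intro borel_measurable_sum borel_measurable_add borel_measurable_const
        measurable_compose[OF _ dual] measurable_component_singleton) auto
  have price: "0 \<le> price_value r v \<and> price_value r v \<le> F + \<rho> \<bullet> v" if "r \<in> S" "v \<in> orthant" for r v
    using dual_value_nonneg[OF that] dual_value_le[OF that] inner_nonneg_orthant[OF \<rho>_nonneg, of v] that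
    by (simp add: price_value_def)
  have kqi: "k * q + i < T" if "k < N" "i < q" for k i
  proof -
    have "k * q + i < Suc k * q" using that by simp
    also have "\<dots> \<le> N * q" using that by (intro mult_right_mono) auto
    finally show ?thesis by (simp add: N)
  qed
  have int\<phi>: "integrable P (\<lambda>\<gamma>. \<phi> v (block q k \<gamma>))" if "v \<in> orthant" "k < N" for v k
  proof (rule integrable_const_bound)
    show "AE \<gamma> in P. norm (\<phi> v (block q k \<gamma>)) \<le> (\<Sum>i<q. F + \<rho> \<bullet> v)"
    proof (rule AE_I2)
      fix \<gamma> assume "\<gamma> \<in> space P"
      then have "\<gamma> (k * q + i) \<in> S" if "i < q" for i using \<gamma>S kqi \<open>k < N\<close> that by blast
      then have "0 \<le> \<phi> v (block q k \<gamma>)" and "\<phi> v (block q k \<gamma>) \<le> (\<Sum>i<q. F + \<rho> \<bullet> v)"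
        unfolding block_eq using price that(1) by (intro sum_nonneg sum_mono; simp)+
      then show "norm (\<phi> v (block q k \<gamma>)) \<le> (\<Sum>i<q. F + \<rho> \<bullet> v)" by simp
    qed
    show "(\<lambda>\<gamma>. \<phi> v (block q k \<gamma>)) \<in> borel_measurable P"
      by (rule measurable_compose[OF bm[OF that(2)] \<phi>m[OF that(1)]])
  qed
  have opt_bounds: "0 \<le> hindsight_opt T \<rho> \<gamma>" "hindsight_opt T \<rho> \<gamma> \<le> real T * F"
    and duality: "v \<in> orthant \<Longrightarrow> hindsight_opt T \<rho> \<gamma> \<le> (\<Sum>t<T. price_value (\<gamma> t) v)"
    if "\<gamma> \<in> space P" for \<gamma> v
    using hindsight_opt_nonneg hindsight_opt_le weak_duality \<gamma>S[OF that] by blast+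
  show int_opt: "integrable P (hindsight_opt T \<rho>)"
  proof (rule integrable_const_bound)
    show "AE \<gamma> in P. norm (hindsight_opt T \<rho> \<gamma>) \<le> real T * F"
      using opt_bounds by (intro AE_I2) auto
    show "hindsight_opt T \<rho> \<in> borel_measurable P" using opt measurable_cong_sets[OF sets refl] by blast
  qed
  define Opt where "Opt = (\<integral>\<gamma>. hindsight_opt T \<rho> \<gamma> \<partial>P)"
  have "Opt \<le> (\<integral>\<gamma>. real T * F \<partial>P)"
    unfolding Opt_def using int_opt opt_bounds by (intro integral_mono) auto
  then have Opt_F: "Opt / N \<le> real q * F" using N0 by (simp add: prob_space N field_simps)
  \<comment> \<open>At a fixed price all blocks have the same expected value, so each carries an
    \<open>N\<close>-th of the dual bound, which weak duality compares with
    \<open>Opt\<close>.\<close>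
  have Opt_\<phi>: "Opt / N \<le> (\<integral>\<gamma>. \<phi> v (block q k \<gamma>) \<partial>P)" if v: "v \<in> orthant" and k: "k < N" for v k
  proof -
    have "(\<integral>\<gamma>. \<phi> v (block q l \<gamma>) \<partial>P) = (\<integral>\<gamma>. \<phi> v (block q k \<gamma>) \<partial>P)" if l: "l < N" for l
    proof -
      have "distr P ?PQ (block q l) = distr P ?PQ (block q k)"
        using P k l unfolding periodic_laws_def N_def by blast
      then show ?thesis
        using integral_distr[OF bm[OF l] \<phi>m[OF v]] integral_distr[OF bm[OF k] \<phi>m[OF v]] by simp
    qed
    then have "real N * (\<integral>\<gamma>. \<phi> v (block q k \<gamma>) \<partial>P) = (\<Sum>l<N. (\<integral>\<gamma>. \<phi> v (block q l \<gamma>) \<partial>P))" by simp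
    also have "\<dots> = (\<integral>\<gamma>. (\<Sum>t<T. price_value (\<gamma> t) v) \<partial>P)"
      unfolding \<phi>_sum[symmetric] using int\<phi> v by (intro Bochner_Integration.integral_sum[symmetric]) auto
    also have "Opt \<le> \<dots>"
      unfolding Opt_def
    proof (rule integral_mono)
      show "integrable P (\<lambda>\<gamma>. \<Sum>t<T. price_value (\<gamma> t) v)"
        unfolding \<phi>_sum[symmetric] using int\<phi> v by (intro Bochner_Integration.integrable_sum) auto
    qed (use int_opt duality v in auto)
    finally show ?thesis using N0 by (simp add: field_simps)
  qed
  have Em: "E k v \<in> sets P" if "k < N" for k v
    using V_measurable that by (simp add: E_def N_def)
  have Im: "I k v \<in> borel_measurable P" "integrable P (I k v)" if "k < N" for k v
    unfolding I_def using Em[OF that] by (auto simp: emeasure_eq_measure)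
  have EI: "(\<integral>\<gamma>. I k v \<gamma> \<partial>P) = prob (E k v)" if "k < N" for k v
    unfolding I_def using Em[OF that] by simp
  \<comment> \<open>Whether block \<open>k\<close> is priced at \<open>v\<close> is decided by the
    earlier blocks, so the expectation factors.\<close>
  have prod: "integrable P (\<lambda>\<gamma>. I k v \<gamma> * \<phi> v (block q k \<gamma>))"
    "(\<integral>\<gamma>. I k v \<gamma> * \<phi> v (block q k \<gamma>) \<partial>P) = prob (E k v) * (\<integral>\<gamma>. \<phi> v (block q k \<gamma>) \<partial>P)"
    if v: "v \<in> orthant" and k: "k < N" for k v
  proof -
    have u: "I k v \<in> borel_measurable ?PT" using Im(1)[OF k] measurable_cong_sets[OF sets refl] by blast
    have past: "I k v \<gamma> = I k v \<gamma>'" if "\<gamma> \<in> space P" "\<gamma>' \<in> space P" "\<And>s. s < k * q \<Longrightarrow> \<gamma> s = \<gamma>' s" for \<gamma> \<gamma>'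
      using V_past[of k \<gamma> \<gamma>'] that k by (simp add: I_def E_def N_def indicator_def)
    show "integrable P (\<lambda>\<gamma>. I k v \<gamma> * \<phi> v (block q k \<gamma>))"
      using past by (intro past_block_independent(2)[OF P q k[unfolded N_def] u Im(2)[OF k] _ \<phi>m[OF v] int\<phi>[OF v k]]) blast
    have "(\<integral>\<gamma>. I k v \<gamma> * \<phi> v (block q k \<gamma>) \<partial>P) = (\<integral>\<gamma>. I k v \<gamma> \<partial>P) * (\<integral>\<gamma>. \<phi> v (block q k \<gamma>) \<partial>P)"
      using past by (intro past_block_independent(1)[OF P q k[unfolded N_def] u Im(2)[OF k] _ \<phi>m[OF v] int\<phi>[OF v k]]) blast
    then show "(\<integral>\<gamma>. I k v \<gamma> * \<phi> v (block q k \<gamma>) \<partial>P) = prob (E k v) * (\<integral>\<gamma>. \<phi> v (block q k \<gamma>) \<partial>P)"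
      unfolding EI[OF k] .
  qed
  \<comment> \<open>The benchmark of block \<open>k\<close> as a finite sum over prices:
    \<open>real q * F\<close> by default, replaced by \<open>\<phi> v\<close> on
    \<open>E k v\<close>. Independence then applies to each summand.\<close>
  define D where "D k \<gamma> = (\<Sum>v\<in>G. I k v \<gamma> * \<phi> v (block q k \<gamma>) - real q * F * I k v \<gamma>) + real q * F" for k \<gamma>
  have intD: "integrable P (D k)" if "k < N" for k
    unfolding D_def using prod(1) Im(2) that G(2)
    by (intro Bochner_Integration.integrable_add Bochner_Integration.integrable_sum
        Bochner_Integration.integrable_diff integrable_mult_right) auto
  \<comment> \<open>The expectation is a mixture, with weights \<open>prob (E k v)\<close> and the
    remaining mass on \<open>real q * F\<close>, of numbers that are all at least
    \<open>Opt / N\<close>.\<close>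
  have ED: "Opt / N \<le> (\<integral>\<gamma>. D k \<gamma> \<partial>P)" if k: "k < N" for k
  proof -
    have "(\<Sum>v\<in>G. prob (E k v)) = prob (\<Union>v\<in>G. E k v)"
      using G(1) Em[OF k] by (intro finite_measure_finite_Union[symmetric])
        (auto simp: disjoint_family_on_def E_def)
    also have "\<dots> \<le> 1" by simp
    finally have "0 \<le> (1 - (\<Sum>v\<in>G. prob (E k v))) * (real q * F - Opt / N)"
      using Opt_F by (intro mult_nonneg_nonneg) auto
    moreover have "(\<Sum>v\<in>G. prob (E k v) * (Opt / N)) \<le> (\<Sum>v\<in>G. prob (E k v) * (\<integral>\<gamma>. \<phi> v (block q k \<gamma>) \<partial>P))"
      using Opt_\<phi>[OF _ k] G(2) by (intro sum_mono mult_left_mono) auto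
    moreover have "(\<integral>\<gamma>. D k \<gamma> \<partial>P) = (\<Sum>v\<in>G. prob (E k v) * (\<integral>\<gamma>. \<phi> v (block q k \<gamma>) \<partial>P)
        - real q * F * prob (E k v)) + real q * F"
    proof -
      have int: "integrable P (\<lambda>\<gamma>. I k v \<gamma> * \<phi> v (block q k \<gamma>) - real q * F * I k v \<gamma>)" if "v \<in> G" for v
        using prod(1) Im(2) k that G(2) by (intro Bochner_Integration.integrable_diff integrable_mult_right) auto
      have "(\<integral>\<gamma>. I k v \<gamma> * \<phi> v (block q k \<gamma>) - real q * F * I k v \<gamma> \<partial>P)
          = prob (E k v) * (\<integral>\<gamma>. \<phi> v (block q k \<gamma>) \<partial>P) - real q * F * prob (E k v)" if "v \<in> G" for v
        using prod[OF _ k, of v] Im(2)[OF k, of v] EI[OF k, of v] that G(2)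
        by (subst Bochner_Integration.integral_diff) auto
      then show ?thesis
        unfolding D_def using int
        by (subst Bochner_Integration.integral_add) (auto simp: Bochner_Integration.integral_sum prob_space)
    qed
    ultimately show ?thesis
      by (simp add: sum_subtractf sum_distrib_left sum_distrib_right algebra_simps)
  qed
  have W: "(\<Sum>t<T. W \<gamma> t) = (\<Sum>k<N. D k \<gamma>)" if \<gamma>: "\<gamma> \<in> space P" for \<gamma>
    unfolding N sum_blocks
  proof (rule sum.cong[OF refl])
    fix k assume "k \<in> {..<N}"
    then have k: "V k \<gamma> \<in> insert None (Some ` G)" using V \<gamma> by (simp add: N_def)
    have W: "W \<gamma> (k * q + i) = (case V k \<gamma> of None \<Rightarrow> F | Some v \<Rightarrow> price_value (\<gamma> (k * q + i)) v)" if "i < q" for i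
      using that by (simp add: W_def)
    show "(\<Sum>i<q. W \<gamma> (k * q + i)) = D k \<gamma>"
    proof (cases "V k \<gamma>")
      case None
      then show ?thesis using W by (simp add: D_def I_def E_def)
    next
      case (Some v)
      then have v: "v \<in> G" using k by auto
      have "D k \<gamma> = (\<Sum>v'\<in>G. if v = v' then \<phi> v' (block q k \<gamma>) - real q * F else 0) + real q * F"
        unfolding D_def using Some \<gamma> by (intro arg_cong2[of _ _ _ _ "(+)"] sum.cong) (auto simp: I_def E_def)
      also have "\<dots> = \<phi> v (block q k \<gamma>)" using G(1) v by simp
      finally show ?thesis using W Some by (simp add: block_eq)
    qed
  qed
  have intW: "integrable P (\<lambda>\<gamma>. \<Sum>k<N. D k \<gamma>)" using intD by (intro Bochner_Integration.integrable_sum) auto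
  then show "integrable P (\<lambda>\<gamma>. \<Sum>t<T. W \<gamma> t)"
    by (subst Bochner_Integration.integrable_cong[OF refl W]) auto
  have "Opt = (\<Sum>k<N. Opt / N)" using N0 by simp
  also have "\<dots> \<le> (\<Sum>k<N. \<integral>\<gamma>. D k \<gamma> \<partial>P)" using ED by (intro sum_mono) auto
  also have "\<dots> = (\<integral>\<gamma>. (\<Sum>t<T. W \<gamma> t) \<partial>P)"
    using intD W by (subst Bochner_Integration.integral_cong[OF refl W]) (auto simp: Bochner_Integration.integral_sum)
  finally show "(\<integral>\<gamma>. hindsight_opt T \<rho> \<gamma> \<partial>P) \<le> (\<integral>\<gamma>. (\<Sum>t<T. W \<gamma> t) \<partial>P)"
    by (simp add: Opt_def)
qed

end

section \<open>Rounding prices down to a finite grid\<close>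

definition round_down :: "real \<Rightarrow> real ^ 'm::finite \<Rightarrow> real ^ 'm" where
  "round_down \<epsilon> u = (\<chi> i. \<epsilon> * of_int \<lfloor>u $ i / \<epsilon>\<rfloor>)"

lemma round_down_bounds:
  assumes "0 < \<epsilon>"
  shows "round_down \<epsilon> u $ i \<le> u $ i" "u $ i - \<epsilon> \<le> round_down \<epsilon> u $ i"
proof -
  have "\<epsilon> * of_int \<lfloor>u $ i / \<epsilon>\<rfloor> \<le> \<epsilon> * (u $ i / \<epsilon>)" "\<epsilon> * (u $ i / \<epsilon> - 1) \<le> \<epsilon> * of_int \<lfloor>u $ i / \<epsilon>\<rfloor>"
    using assms by (intro mult_left_mono; linarith)+
  with assms show "round_down \<epsilon> u $ i \<le> u $ i" "u $ i - \<epsilon> \<le> round_down \<epsilon> u $ i"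
    by (simp_all add: round_down_def right_diff_distrib)
qed

lemma round_down_orthant:
  assumes "0 < \<epsilon>" "u \<in> orthant"
  shows "round_down \<epsilon> u \<in> orthant"
  using assms by (simp add: round_down_def less_eq_vec_def)

lemma l1norm_round_down:
  fixes u :: "real ^ 'm::finite"
  assumes "0 < \<epsilon>"
  shows "l1norm (round_down \<epsilon> u - u) \<le> real CARD('m) * \<epsilon>"
proof -
  have "l1norm (round_down \<epsilon> u - u) \<le> (\<Sum>i\<in>(UNIV :: 'm set). \<epsilon>)"
    unfolding l1norm_def
  proof (rule sum_mono)
    show "\<bar>(round_down \<epsilon> u - u) $ i\<bar> \<le> \<epsilon>" for i
      using round_down_bounds[OF assms, of u i] by simp
  qed
  then show ?thesis by simp
qed

text \<open>Finitely many block prices are what \<open>expected_benchmark\<close> asks for. Rounding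
  downwards never raises \<open>\<rho> \<bullet> v\<close>, as \<open>benchmark_after_stop\<close>
  requires.\<close>

lemma finite_round_down:
  fixes K :: real
  assumes "0 < \<epsilon>"
  shows "finite (round_down \<epsilon> ` {u :: real ^ 'm::finite. u \<in> orthant \<and> (\<forall>i. u $ i \<le> K)})"
proof (rule finite_subset)
  let ?Z = "UNIV \<rightarrow>\<^sub>E {0..\<lfloor>K / \<epsilon>\<rfloor>} :: ('m \<Rightarrow> int) set"
  show "finite ((\<lambda>f. \<chi> i. \<epsilon> * of_int (f i)) ` ?Z)" by (intro finite_imageI finite_PiE) auto
  show "round_down \<epsilon> ` {u :: real ^ 'm. u \<in> orthant \<and> (\<forall>i. u $ i \<le> K)} \<subseteq> (\<lambda>f. \<chi> i. \<epsilon> * of_int (f i)) ` ?Z"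
  proof safe
    fix u :: "real ^ 'm" assume u: "0 \<le> u" "\<forall>i. u $ i \<le> K"
    have "(\<lambda>i. \<lfloor>u $ i / \<epsilon>\<rfloor>) \<in> ?Z"
      using u assms by (auto simp: less_eq_vec_def intro!: floor_mono divide_right_mono)
    then show "round_down \<epsilon> u \<in> (\<lambda>f. \<chi> i. \<epsilon> * of_int (f i)) ` ?Z"
      unfolding round_down_def by (rule rev_image_eqI) simp
  qed
qed

lemma pred_vec_le:
  assumes [measurable]: "f \<in> borel_measurable M"
  shows "Measurable.pred M (\<lambda>w. f w \<le> (c :: real ^ 'm::finite))"
  unfolding less_eq_vec_def by measurable

lemma pred_round_down_eq:
  assumes [measurable]: "f \<in> borel_measurable M"
  shows "Measurable.pred M (\<lambda>w. round_down \<epsilon> (f w) = (v :: real ^ 'm::finite))"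
proof -
  have [measurable]: "(\<lambda>w. real_of_int \<lfloor>f w $ i / \<epsilon>\<rfloor>) \<in> borel_measurable M" for i
    by (intro measurable_compose[OF _ borel_measurable_real_floor] borel_measurable_divide
        borel_measurable_const measurable_compose[OF assms borel_measurable_nth])
  show ?thesis unfolding vec_eq_iff round_down_def vec_lambda_beta by measurable
qed

section \<open>Regret in expectation\<close>

context allocation
begin

lemma trivial_regret:
  assumes P: "P \<in> periodic_laws T M q" and M: "space M = S"
    and run: "\<And>\<gamma>. \<gamma> \<in> {..<T} \<rightarrow>\<^sub>E S \<Longrightarrow> mirror_descent_run T \<rho> \<eta> h \<mu>1 \<gamma> (xt \<gamma>) (x \<gamma>) (B \<gamma>) (\<mu> \<gamma>)"
  shows "(\<integral>\<gamma>. (hindsight_opt T \<rho> \<gamma> - total_reward T \<gamma> (x \<gamma>)) \<partial>P) \<le> real T * F"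
proof -
  interpret prob_space P using P by (simp add: periodic_laws_def)
  have "sets P = sets (\<Pi>\<^sub>M t\<in>{..<T}. M)" using P by (simp add: periodic_laws_def)
  from sets_eq_imp_space_eq[OF this] have spaceP: "space P = {..<T} \<rightarrow>\<^sub>E S" by (simp add: space_PiM M)
  have "hindsight_opt T \<rho> \<gamma> - total_reward T \<gamma> (x \<gamma>) \<le> real T * F" if "\<gamma> \<in> space P" for \<gamma>
  proof -
    have \<gamma>: "\<gamma> \<in> {..<T} \<rightarrow>\<^sub>E S" "\<And>t. t < T \<Longrightarrow> \<gamma> t \<in> S" using that by (auto simp: spaceP)
    then show ?thesis
      using hindsight_opt_le[of T \<gamma>] total_reward_nonneg[of T \<gamma> "x \<gamma>"] run_action[OF run] by fastforce
  qed
  \<comment> \<open>Integrability of the regret is not assumed here; without it the integral is 0,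
    and the bound has to be nonnegative.\<close>
  moreover have "0 \<le> real T * F" using F_nonneg by simp
  ultimately have "(\<integral>\<gamma>. (hindsight_opt T \<rho> \<gamma> - total_reward T \<gamma> (x \<gamma>)) \<partial>P) \<le> (\<integral>\<gamma>. real T * F \<partial>P)"
    by (intro integral_mono') auto
  then show ?thesis by (simp add: prob_space)
qed

text \<open>The pathwise bound \<open>sum_benchmark_le\<close> is integrated, and
  \<open>expected_benchmark\<close> compares the result with the hindsight optimum. Block prices are
  rounded for this, at an arbitrarily small cost \<open>\<delta>\<close>.\<close>

lemma periodic_regret:
  assumes P: "P \<in> periodic_laws T M q" and M: "space M = S" and q: "q dvd T" "0 < q" and T: "0 < T"
    and h: "reference_function \<sigma> h" and \<eta>: "0 < \<eta>"
    and initial: "\<mu>1 \<in> orthant" "h differentiable (at \<mu>1 within orthant)"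
    and algorithm: "mirror_descent_algorithm T \<rho> \<eta> h \<mu>1 S xt x B \<mu>"
    and measurable: "measurable_model T \<rho> M xt x \<mu>"
    and C: "bregman h 0 \<mu>1 \<le> C" "\<And>j. bregman h ((F / \<rho> $ j) *\<^sub>R axis j 1) \<mu>1 \<le> C"
    and small: "C / \<eta> < real T * F"
  shows "(\<integral>\<gamma>. (hindsight_opt T \<rho> \<gamma> - total_reward T \<gamma> (x \<gamma>)) \<partial>P)
    \<le> F * b / \<rho>min + (b + \<rho>max)\<^sup>2 / (2 * \<sigma>) * \<eta> * real T + C / \<eta>
      + sqrt 2 / \<sigma> * (b + \<rho>max)\<^sup>2 * real q * \<eta> * real T" (is "_ \<le> ?K")
proof (rule field_le_epsilon)
  fix \<delta> :: real assume \<delta>: "0 < \<delta>"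
  \<comment> \<open>Rounding moves a price by at most \<open>real CARD('m) * \<epsilon>\<close> in
    l1 norm, so the Lipschitz errors of \<open>T\<close> periods sum to at most
    \<open>\<delta>\<close>.\<close>
  define \<epsilon> where "\<epsilon> = \<delta> / (real T * subgrad_bound * real CARD('m))"
  have "0 < real T * subgrad_bound * real CARD('m)" using T subgrad_bound_pos by simp
  then have \<epsilon>: "0 < \<epsilon>" "real T * (subgrad_bound * (real CARD('m) * \<epsilon>)) = \<delta>"
    using \<delta> T subgrad_bound_pos by (simp_all add: \<epsilon>_def)
  let ?PT = "\<Pi>\<^sub>M t\<in>{..<T}. M"
  interpret prob_space P using P by (simp add: periodic_laws_def)
  have sets: "sets P = sets ?PT" using P by (simp add: periodic_laws_def)
  have spaceP: "space P = {..<T} \<rightarrow>\<^sub>E S" "space P = space ?PT"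
    using sets_eq_imp_space_eq[OF sets] by (simp_all add: space_PiM M)
  have run: "mirror_descent_run T \<rho> \<eta> h \<mu>1 \<gamma> (xt \<gamma>) (x \<gamma>) (B \<gamma>) (\<mu> \<gamma>)" if "\<gamma> \<in> space P" for \<gamma>
    using algorithm that by (simp add: mirror_descent_algorithm_def spaceP(1))
  have nonanticipating: "xt \<gamma> t = xt \<gamma>' t"
    if "\<gamma> \<in> space P" "\<gamma>' \<in> space P" "t < T" "\<And>s. s \<le> t \<Longrightarrow> \<gamma> s = \<gamma>' s" for \<gamma> \<gamma>' t
    using algorithm that unfolding mirror_descent_algorithm_def spaceP(1) by blast
  have \<gamma>S: "\<gamma> t \<in> S" if "\<gamma> \<in> space P" "t < T" for \<gamma> t
    using that by (auto simp: spaceP(1))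
  have alloc: "allocation_run S \<rho> F b \<rho>min \<rho>max T \<eta> \<sigma> h \<mu>1 C \<gamma> (xt \<gamma>) (x \<gamma>) (B \<gamma>) (\<mu> \<gamma>)"
    if "\<gamma> \<in> space P" for \<gamma>
    using h \<eta> initial C \<gamma>S[OF that] run[OF that] allocation_axioms
    by (intro allocation_run.intro allocation_run_axioms.intro)
  define dem where "dem \<gamma> n = (\<Sum>t<n. consumption (\<gamma> t) (xt \<gamma> t))" for \<gamma> n
  define V where "V k \<gamma> = (if dem \<gamma> (k * q) \<le> real T *\<^sub>R \<rho> \<and> \<rho> \<bullet> \<mu> \<gamma> (k * q) < F
    then Some (round_down \<epsilon> (\<mu> \<gamma> (k * q))) else None)" for k \<gamma>
  \<comment> \<open>A price with \<open>\<rho> \<bullet> u < F\<close> has all coordinates at most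
    \<open>F / \<rho>min\<close>, so \<open>G\<close> contains all block prices that occur.\<close>
  define G where "G = round_down \<epsilon> ` {u :: real ^ 'm. u \<in> orthant \<and> (\<forall>i. u $ i \<le> F / \<rho>min)}"
  have kq: "k * q < T" if "k < T div q" for k
  proof -
    have "k * q < T div q * q" using that q(2) by simp
    then show ?thesis using q(1) by simp
  qed
  have V_G: "V k \<gamma> \<in> insert None (Some ` G)" if k: "k < T div q" and \<gamma>: "\<gamma> \<in> space P" for k \<gamma>
  proof -
    interpret run: allocation_run S \<rho> F b \<rho>min \<rho>max T \<eta> \<sigma> h \<mu>1 C \<gamma> "xt \<gamma>" "x \<gamma>" "B \<gamma>" "\<mu> \<gamma>"
      by (rule alloc[OF \<gamma>])
    have or: "\<mu> \<gamma> (k * q) \<in> orthant" using run.iterate_orthant kq[OF k] by simp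
    then have nonneg: "0 \<le> \<mu> \<gamma> (k * q) $ i" for i by (simp add: less_eq_vec_def)
    have "\<mu> \<gamma> (k * q) $ i \<le> F / \<rho>min" if "\<rho> \<bullet> \<mu> \<gamma> (k * q) < F" for i
    proof -
      have "\<rho>min * \<mu> \<gamma> (k * q) $ i \<le> \<rho> $ i * \<mu> \<gamma> (k * q) $ i"
        using nonneg \<rho>min_le by (intro mult_right_mono) auto
      also have "\<dots> \<le> \<rho> \<bullet> \<mu> \<gamma> (k * q)"
        unfolding inner_vec_def inner_real_def using nonneg \<rho>_pos
        by (intro member_le_sum) (auto intro: mult_nonneg_nonneg less_imp_le)
      finally show ?thesis using that \<rho>min_pos by (simp add: field_simps)
    qed
    then show ?thesis using or by (auto simp: V_def G_def)
  qed
  \<comment> \<open>Nonanticipation makes the earlier proposals coincide; these determine the demand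
    and, by \<open>iterates_agree\<close>, the price.\<close>
  have V_past: "V k \<gamma> = V k \<gamma>'"
    if k: "k < T div q" and \<gamma>: "\<gamma> \<in> space P" "\<gamma>' \<in> space P" "\<And>s. s < k * q \<Longrightarrow> \<gamma> s = \<gamma>' s" for k \<gamma> \<gamma>'
  proof -
    have xt: "xt \<gamma> s = xt \<gamma>' s" if "s < k * q" for s
      using that kq[OF k] \<gamma> by (intro nonanticipating) auto
    then have "dem \<gamma> (k * q) = dem \<gamma>' (k * q)" using \<gamma> by (simp add: dem_def)
    moreover have "\<mu> \<gamma> (k * q) = \<mu> \<gamma>' (k * q)"
      by (rule iterates_agree[OF h \<eta> run[OF \<gamma>(1)] run[OF \<gamma>(2)] less_imp_le[OF kq[OF k]] \<gamma>(3) xt])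
    ultimately show ?thesis by (simp add: V_def)
  qed
  have V_meas: "{\<gamma> \<in> space P. V k \<gamma> = Some v} \<in> sets P" if k: "k < T div q" for k v
  proof -
    have [measurable]: "(\<lambda>\<gamma>. \<mu> \<gamma> (k * q)) \<in> borel_measurable ?PT"
      using measurable kq[OF k] by (simp add: measurable_model_def)
    have [measurable]: "(\<lambda>\<gamma>. dem \<gamma> (k * q)) \<in> borel_measurable ?PT"
      unfolding dem_def using measurable kq[OF k] by (intro borel_measurable_sum) (simp add: measurable_model_def)
    note [measurable] = pred_vec_le pred_round_down_eq
    have "{\<gamma> \<in> space ?PT. dem \<gamma> (k * q) \<le> real T *\<^sub>R \<rho> \<and> \<rho> \<bullet> \<mu> \<gamma> (k * q) < F
        \<and> round_down \<epsilon> (\<mu> \<gamma> (k * q)) = v} \<in> sets ?PT" by measurable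
    also have "{\<gamma> \<in> space ?PT. dem \<gamma> (k * q) \<le> real T *\<^sub>R \<rho> \<and> \<rho> \<bullet> \<mu> \<gamma> (k * q) < F
        \<and> round_down \<epsilon> (\<mu> \<gamma> (k * q)) = v} = {\<gamma> \<in> space P. V k \<gamma> = Some v}"
      unfolding spaceP(2) V_def by auto
    finally show ?thesis by (simp add: sets)
  qed
  define W where "W \<gamma> t = (case V (t div q) \<gamma> of None \<Rightarrow> F | Some v \<Rightarrow> price_value (\<gamma> t) v)" for \<gamma> t
  have dual: "(\<lambda>r. dual_value r \<nu>) \<in> borel_measurable M" if "\<nu> \<in> orthant" for \<nu>
    using measurable that by (simp add: measurable_model_def dual_value_def)
  have opt: "hindsight_opt T \<rho> \<in> borel_measurable ?PT"
    using measurable by (simp add: measurable_model_def)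
  have G: "finite G" "G \<subseteq> orthant"
    unfolding G_def using finite_round_down[OF \<epsilon>(1)] round_down_orthant[OF \<epsilon>(1)] by blast+
  note ED = expected_benchmark[where V = V, OF P M q T _ opt G, folded W_def]
  have E: "integrable P (\<lambda>\<gamma>. \<Sum>t<T. W \<gamma> t)"
    "(\<integral>\<gamma>. hindsight_opt T \<rho> \<gamma> \<partial>P) \<le> (\<integral>\<gamma>. (\<Sum>t<T. W \<gamma> t) \<partial>P)"
    "integrable P (hindsight_opt T \<rho>)"
    using dual V_G V_meas V_past by (intro ED; blast)+
  have W_le: "(\<Sum>t<T. W \<gamma> t) \<le> total_reward T \<gamma> (x \<gamma>) + (?K + \<delta>)" if \<gamma>: "\<gamma> \<in> space P" for \<gamma>
  proof -
    interpret run: allocation_run S \<rho> F b \<rho>min \<rho>max T \<eta> \<sigma> h \<mu>1 C \<gamma> "xt \<gamma>" "x \<gamma>" "B \<gamma>" "\<mu> \<gamma>"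
      by (rule alloc[OF \<gamma>])
    let ?v = "\<lambda>k. round_down \<epsilon> (\<mu> \<gamma> (k * q))"
    have or: "\<mu> \<gamma> (k * q) \<in> orthant" if "k < T div q" for k using run.iterate_orthant kq[OF that] by simp
    have le: "\<rho> \<bullet> ?v k \<le> \<rho> \<bullet> \<mu> \<gamma> (k * q)" for k
      unfolding inner_vec_def inner_real_def using \<rho>_pos round_down_bounds(1)[OF \<epsilon>(1)]
      by (intro sum_mono mult_left_mono) (auto intro: less_imp_le)
    have "W \<gamma> t = run.benchmark q ?v t" for t
      by (simp add: W_def V_def run.benchmark_def run.demand_def dem_def)
    then show ?thesis
      using run.sum_benchmark_le[OF q small round_down_orthant[OF \<epsilon>(1) or] l1norm_round_down[OF \<epsilon>(1)] le] \<epsilon>(2)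
      by simp
  qed
  have int: "integrable P (\<lambda>\<gamma>. total_reward T \<gamma> (x \<gamma>))"
  proof (rule integrable_const_bound)
    show "AE \<gamma> in P. norm (total_reward T \<gamma> (x \<gamma>)) \<le> real T * F"
    proof (rule AE_I2)
      fix \<gamma> assume \<gamma>: "\<gamma> \<in> space P"
      have act: "x \<gamma> t \<in> actions (\<gamma> t)" if "t < T" for t
        using run_action[OF run[OF \<gamma>] that \<gamma>S[OF \<gamma> that]] .
      show "norm (total_reward T \<gamma> (x \<gamma>)) \<le> real T * F"
        using total_reward_le[of T \<gamma> "x \<gamma>"] total_reward_nonneg[of T \<gamma> "x \<gamma>"] act \<gamma>S[OF \<gamma>] by simp
    qed
    have "(\<lambda>\<gamma>. total_reward T \<gamma> (x \<gamma>)) \<in> borel_measurable ?PT"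
      unfolding total_reward_def using measurable by (intro borel_measurable_sum) (simp add: measurable_model_def)
    then show "(\<lambda>\<gamma>. total_reward T \<gamma> (x \<gamma>)) \<in> borel_measurable P"
      using measurable_cong_sets[OF sets refl] by blast
  qed
  have "(\<integral>\<gamma>. hindsight_opt T \<rho> \<gamma> \<partial>P) \<le> (\<integral>\<gamma>. (\<Sum>t<T. W \<gamma> t) \<partial>P)" by (rule E(2))
  also have "\<dots> \<le> (\<integral>\<gamma>. total_reward T \<gamma> (x \<gamma>) + (?K + \<delta>) \<partial>P)"
    using E(1) int W_le by (intro integral_mono) auto
  also have "\<dots> = (\<integral>\<gamma>. total_reward T \<gamma> (x \<gamma>) \<partial>P) + (?K + \<delta>)"
    using int by (simp add: prob_space)
  finally show "(\<integral>\<gamma>. (hindsight_opt T \<rho> \<gamma> - total_reward T \<gamma> (x \<gamma>)) \<partial>P) \<le> ?K + \<delta>"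
    using int E(3) by simp
qed

end

section \<open>The regret bound for all step sizes, zero included\<close>

theorem theorem6:
  fixes S :: "('d::finite, 'm::finite) request set"
    and M :: "('d, 'm) request measure"
    and \<rho> \<mu>1 :: "real ^ 'm"
    and h :: "real ^ 'm \<Rightarrow> real"
    and T q :: nat
    and \<eta> \<sigma> fbar bbar \<rho>min \<rho>max C1 C2 C3 C4 :: real
    and xt x :: "(nat \<Rightarrow> ('d, 'm) request) \<Rightarrow> nat \<Rightarrow> real ^ 'd"
    and B \<mu> :: "(nat \<Rightarrow> ('d, 'm) request) \<Rightarrow> nat \<Rightarrow> real ^ 'm"
  assumes requests: "\<forall>r\<in>S. well_formed r" "space M = S"
    and resources: "\<forall>j. 0 < \<rho> $ j"
    and horizon: "1 \<le> T" "1 \<le> q" "q dvd T"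
    and assumption1: "bounded_requests S fbar bbar"
    and assumption2: "reference_function \<sigma> h"
    and step_size: "0 \<le> \<eta>"
    and initial: "\<mu>1 \<in> orthant" "h differentiable (at \<mu>1 within orthant)"
    and algorithm: "mirror_descent_algorithm T \<rho> \<eta> h \<mu>1 S xt x B \<mu>"
    and measurable: "measurable_model T \<rho> M xt x \<mu>"
    and "\<rho>min = Min (range (\<lambda>j. \<rho> $ j))"
    and "\<rho>max = Max (range (\<lambda>j. \<rho> $ j))"
    and "C1 = fbar * bbar / \<rho>min"
    and "C2 = (bbar + \<rho>max)\<^sup>2 / (2 * \<sigma>)"
    and "C3 = Max ((\<lambda>\<nu>. bregman h \<nu> \<mu>1) ` insert 0 (range (\<lambda>j. (fbar / \<rho> $ j) *\<^sub>R axis j 1)))"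
    and "C4 = sqrt 2 / \<sigma> * (bbar + \<rho>max)\<^sup>2"
  shows "(SUP P \<in> periodic_laws T M q.
            ereal (\<integral>\<gamma>. (hindsight_opt T \<rho> \<gamma> - total_reward T \<gamma> (x \<gamma>)) \<partial>P))
         \<le> ereal C1 + ereal (C2 * \<eta> * real T) + ereal C3 / ereal \<eta>
             + ereal (C4 * real q * \<eta> * real T)"
proof (rule SUP_least)
  fix P assume P: "P \<in> periodic_laws T M q"
  let ?I = "\<integral>\<gamma>. (hindsight_opt T \<rho> \<gamma> - total_reward T \<gamma> (x \<gamma>)) \<partial>P"
  interpret allocation S \<rho> fbar bbar \<rho>min \<rho>max
  proof
    have "\<rho>min \<in> range (\<lambda>j. \<rho> $ j)" using assms(14) by (simp add: Min_in)
    then show "\<exists>j. \<rho> $ j = \<rho>min" by auto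
    then show "0 < \<rho>min" using resources by metis
  qed (use assms in auto)
  have \<sigma>: "0 < \<sigma>" "strongly_convex \<sigma> h" using assumption2 by (auto simp: reference_function_def)
  have C3: "bregman h 0 \<mu>1 \<le> C3" "bregman h ((fbar / \<rho> $ j) *\<^sub>R axis j 1) \<mu>1 \<le> C3" for j
    unfolding assms(18) by (intro Max_ge; simp)+
  have V0: "\<sigma> / 2 * (l1norm (0 - \<mu>1))\<^sup>2 \<le> bregman h 0 \<mu>1"
    using initial by (intro bregman_lower_bound[OF \<sigma>(2)]) auto
  have "0 \<le> \<sigma> / 2 * (l1norm (0 - \<mu>1))\<^sup>2" using \<sigma>(1) by simp
  with V0 C3(1) have C3_nonneg: "0 \<le> C3" by linarith
  have nonneg: "0 \<le> C1" "0 \<le> C2" "0 \<le> C4"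
    using assms(16,17,19) F_nonneg b_nonneg \<rho>min_pos \<sigma>(1) by auto
  have run: "mirror_descent_run T \<rho> \<eta> h \<mu>1 \<gamma> (xt \<gamma>) (x \<gamma>) (B \<gamma>) (\<mu> \<gamma>)" if "\<gamma> \<in> {..<T} \<rightarrow>\<^sub>E S" for \<gamma>
    using algorithm that by (simp add: mirror_descent_algorithm_def)
  have trivial: "?I \<le> real T * fbar" using P requests(2) run by (rule trivial_regret)
  show "ereal ?I \<le> ereal C1 + ereal (C2 * \<eta> * real T) + ereal C3 / ereal \<eta> + ereal (C4 * real q * \<eta> * real T)"
  proof (cases "\<eta> = 0")
    case False
    then have \<eta>: "0 < \<eta>" using step_size by simp
    have "?I \<le> C1 + C2 * \<eta> * real T + C3 / \<eta> + C4 * real q * \<eta> * real T"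
    \<comment> \<open>Once \<open>C3 / \<eta>\<close> reaches \<open>real T * fbar\<close>, the
      trivial bound suffices.\<close>
    proof (cases "C3 / \<eta> < real T * fbar")
      case True
      show ?thesis
        using periodic_regret[OF P requests(2) horizon(3) _ _ assumption2 \<eta> initial algorithm measurable C3 True]
          horizon assms(16,17,19) by simp
    next
      case False
      moreover have "0 \<le> C2 * \<eta> * real T" "0 \<le> C4 * real q * \<eta> * real T" using nonneg \<eta> by auto
      ultimately show ?thesis using trivial nonneg by linarith
    qed
    then show ?thesis using \<eta> by simp
  next
    case True
    show ?thesis
    \<comment> \<open>At step size 0 a positive \<open>C3\<close> makes the right-hand side
      infinite, but \<open>0 / 0 = 0\<close> for extended reals. If \<open>C3 = 0\<close>, strong
      convexity puts \<open>\<mu>1\<close> and all comparison points at 0, so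
      \<open>fbar = 0\<close> and the trivial bound is 0.\<close>
    proof (cases "C3 = 0")
      case False
      then show ?thesis using True C3_nonneg by simp
    next
      case C3_0: True
      have "\<sigma> * (l1norm (0 - \<mu>1))\<^sup>2 \<le> 0" using V0 C3(1) C3_0 by linarith
      then have \<mu>1: "\<mu>1 = 0" using \<sigma>(1) by (simp add: mult_le_0_iff l1norm_eq_0)
      fix j :: 'm
      let ?\<nu> = "(fbar / \<rho> $ j) *\<^sub>R axis j (1::real)"
      have "\<sigma> / 2 * (l1norm (?\<nu> - \<mu>1))\<^sup>2 \<le> bregman h ?\<nu> \<mu>1"
        using initial F_nonneg \<rho>_pos[of j]
        by (intro bregman_lower_bound[OF \<sigma>(2)]) (auto simp: less_eq_vec_def axis_def)
      then have "\<sigma> * (l1norm (?\<nu> - \<mu>1))\<^sup>2 \<le> 0" using C3(2)[of j] C3_0 by linarith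
      then have "?\<nu> = 0" using \<sigma>(1) by (simp add: \<mu>1 mult_le_0_iff l1norm_eq_0)
      then have "fbar = 0" using \<rho>_pos[of j] by (simp add: axis_eq_0_iff)
      then show ?thesis using trivial True C3_0 nonneg by simp
    qed
  qed
qed

end
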